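(* Let $d\in\mathbb{N}$, $0<p<1$, $0<q\le\infty$, $\alpha>\max\{0,d(1-\frac1q)\}$ (with $\frac1q=0$ if $q=\infty$), and $\psi\in\mathcal{H}_\alpha$. Then for every $f\in L_q(\mathbb{T}^d)$ (with $f\in C(\mathbb{T}^d)$, i.e. $f$ continuous, if $q=\infty$) and every $\delta>0$, $$ K\big(f,\delta;L_q(\mathbb{T}^d),W_p^\psi(\mathbb{T}^d)\big)=\inf_{g\in W_p^\psi(\mathbb{T}^d)}\Big(\|f-g\|_{L_q(\mathbb{T}^d)}+\delta\,\|\psi(D)g\|_{L_p(\mathbb{T}^d)}\Big)=0 . $$
   Context: $\mathbb{T}^d=\mathbb{R}^d/2\pi\mathbb{Z}^d$. Functions are complex-valued. For $0<p<\infty$, $L_p(\mathbb{T}^d)$ is the space of measurable $f$ with $\|f\|_{L_p(\mathbb{T}^d)}=\big(\int_{\mathbb{T}^d}|f(x)|^p\,dx\big)^{1/p}<\infty$ (a quasi-norm if $p<1$), and $L_\infty(\mathbb{T}^d)$ carries the essential supremum norm. If $f-g\notin L_q(\mathbb{T}^d)$, then $\|f-g\|_{L_q(\mathbb{T}^d)}=+\infty$. For $f\in L_1(\mathbb{T}^d)$ and $k\in\mathbb{Z}^d$, $\widehat f(k)=(2\pi)^{-d}\int_{\mathbb{T}^d}f(x)e^{-i(x,k)}\,dx$, where $(x,k)=x_1k_1+\dots+x_dk_d$. The class $\mathcal{H}_\alpha$, $\alpha\in\mathbb{R}$, consists of all functions $\psi$ such that $\psi(\xi)\ne 0$ for $\xi\in\mathbb{R}^d\setminus\{0\}$,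 $\psi\in C^\infty(\mathbb{R}^d\setminus\{0\})$ (complex-valued), and $\psi$ is homogeneous of order $\alpha$: $\psi(\tau\xi)=\tau^\alpha\psi(\xi)$ for all $\tau>0$ and $\xi\in\mathbb{R}^d\setminus\{0\}$. The Weyl-type differentiation operator generated by $\psi\in\mathcal{H}_\alpha$ is $$ \psi(D):\ \sum_{k\in\mathbb{Z}^d}c_ke^{i(k,x)}\ \mapsto\ \sum_{k\in\mathbb{Z}^d\setminus\{0\}}\psi(k)c_ke^{i(k,x)}, $$ applied to $g\in L_1(\mathbb{T}^d)$ through its Fourier series ($c_k=\widehat g(k)$). For $\psi\in\mathcal{H}_\alpha$, $\alpha>0$, $0<p\le1$, $$ W_p^\psi(\mathbb{T}^d)=\{g\in L_1(\mathbb{T}^d):\ \psi(D)g\in L_p(\mathbb{T}^d)\},\qquad |g|_{W_p^\psi}=\|\psi(D)g\|_{L_p(\mathbb{T}^d)} . $$ Here $\psi(D)g\in L_p(\mathbb{T}^d)$ is understood to mean that the series $\sum_{k\ne0}\psi(k)\widehat g(k)e^{i(k,x)}$ is the Fourier series of an integrable function, denoted $\psi(D)g$ (such a function lies in $L_p(\mathbb{T}^d)$ automatically since $p\le1$). *)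

theory Defs
  imports "HOL-Probability.Essential_Supremum"
begin

text \<open>
  Functions on the torus \<open>R^d / 2 pi Z^d\<close> are rendered as functions on \<open>R^d\<close> that are
  \<open>2 pi\<close>-periodic in every coordinate, with \<open>d = CARD('n)\<close>; integration over the torus
  is Lebesgue integration over the cube \<open>[0, 2 pi]^d\<close> (not normalised).
\<close>

definition periodic :: "(real ^ 'n \<Rightarrow> complex) \<Rightarrow> bool" where
  "periodic f \<longleftrightarrow> (\<forall>x i. f (x + axis i (2 * pi)) = f x)"

definition torus_measure :: "(real ^ 'n) measure" where
  "torus_measure = lebesgue_on (cbox 0 (\<chi> i. 2 * pi))"

text \<open>
  The \<open>L_q\<close> (quasi-)norm for \<open>0 < q \<le> \<infinity>\<close>, with value \<open>\<infinity>\<close> for measurable functions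
  that do not lie in \<open>L_q\<close>.
\<close>

definition torus_norm :: "ennreal \<Rightarrow> (real ^ 'n \<Rightarrow> complex) \<Rightarrow> ennreal" where
  "torus_norm q f =
    (if q = \<infinity> then esssup torus_measure (\<lambda>x. ennreal (cmod (f x)))
     else let r = enn2real q;
              J = (\<integral>\<^sup>+ x. ennreal (cmod (f x) powr r) \<partial>torus_measure)
          in if J = \<infinity> then \<infinity> else ennreal (enn2real J powr (1 / r)))"

definition torus_L :: "ennreal \<Rightarrow> (real ^ 'n \<Rightarrow> complex) set" where
  "torus_L q = {f. periodic f \<and> f \<in> borel_measurable torus_measure \<and> torus_norm q f < \<infinity>}"

definition freq :: "int ^ 'n \<Rightarrow> real ^ 'n" where
  "freq k = (\<chi> i. of_int (k $ i))"

definition fourier_coeff :: "(real ^ 'n \<Rightarrow> complex) \<Rightarrow> int ^ 'n \<Rightarrow> complex" where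
  "fourier_coeff f k =
    (\<integral>x. f x * exp (- \<i> * complex_of_real (x \<bullet> freq k)) \<partial>torus_measure) / of_real ((2 * pi) ^ CARD('n))"

text \<open>
  On an open set \<open>S\<close>: all directional derivatives of order up to \<open>m\<close> exist, are continuous,
  and those of order below \<open>m\<close> are Frechet differentiable; this is real \<open>C^m\<close> smoothness.
\<close>

primrec Ck_on :: "nat \<Rightarrow> 'a::real_normed_vector set \<Rightarrow> ('a \<Rightarrow> 'b::real_normed_vector) \<Rightarrow> bool" where
  "Ck_on 0 S f \<longleftrightarrow> continuous_on S f"
| "Ck_on (Suc m) S f \<longleftrightarrow>
    (\<forall>x\<in>S. f differentiable (at x)) \<and> (\<forall>v. Ck_on m S (\<lambda>x. frechet_derivative f (at x) v))"

definition C_infinity_on :: "'a::real_normed_vector set \<Rightarrow> ('a \<Rightarrow> 'b::real_normed_vector) \<Rightarrow> bool" where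
  "C_infinity_on S f \<longleftrightarrow> (\<forall>m. Ck_on m S f)"

text \<open>The value \<open>\<psi> 0\<close> is left arbitrary; it is never used below.\<close>

definition class_H :: "real \<Rightarrow> (real ^ 'n \<Rightarrow> complex) set" where
  "class_H \<alpha> = {\<psi>. (\<forall>\<xi>. \<xi> \<noteq> 0 \<longrightarrow> \<psi> \<xi> \<noteq> 0) \<and> C_infinity_on (UNIV - {0}) \<psi> \<and>
    (\<forall>\<tau>>0. \<forall>\<xi>. \<xi> \<noteq> 0 \<longrightarrow> \<psi> (\<tau> *\<^sub>R \<xi>) = of_real (\<tau> powr \<alpha>) * \<psi> \<xi>)}"

text \<open>\<open>h\<close> is an integrable function whose Fourier series is \<open>\<psi>(D)\<close> applied to that of \<open>g\<close>.\<close>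

definition has_weyl_derivative ::
    "(real ^ 'n \<Rightarrow> complex) \<Rightarrow> (real ^ 'n \<Rightarrow> complex) \<Rightarrow> (real ^ 'n \<Rightarrow> complex) \<Rightarrow> bool" where
  "has_weyl_derivative \<psi> g h \<longleftrightarrow> h \<in> torus_L 1 \<and>
    (\<forall>k. fourier_coeff h k = (if k = 0 then 0 else \<psi> (freq k) * fourier_coeff g k))"

text \<open>
  An integrable function is determined almost everywhere by its Fourier coefficients, so the
  choice of representative does not affect the norms of \<open>\<psi>(D) g\<close>. The value is meaningful
  only if some \<open>h\<close> with \<open>has_weyl_derivative \<psi> g h\<close> exists.
\<close>

definition weyl_derivative ::
    "(real ^ 'n \<Rightarrow> complex) \<Rightarrow> (real ^ 'n \<Rightarrow> complex) \<Rightarrow> (real ^ 'n \<Rightarrow> complex)" where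
  "weyl_derivative \<psi> g = (SOME h. has_weyl_derivative \<psi> g h)"

definition weyl_space :: "ennreal \<Rightarrow> (real ^ 'n \<Rightarrow> complex) \<Rightarrow> (real ^ 'n \<Rightarrow> complex) set" where
  "weyl_space p \<psi> =
    {g \<in> torus_L 1. (\<exists>h. has_weyl_derivative \<psi> g h) \<and> weyl_derivative \<psi> g \<in> torus_L p}"

definition K_functional ::
    "ennreal \<Rightarrow> ennreal \<Rightarrow> (real ^ 'n \<Rightarrow> complex) \<Rightarrow> (real ^ 'n \<Rightarrow> complex) \<Rightarrow> real \<Rightarrow> ennreal" where
  "K_functional q p \<psi> f \<delta> =
    (INF g \<in> weyl_space p \<psi>. torus_norm q (\<lambda>x. f x - g x) + ennreal \<delta> * torus_norm p (weyl_derivative \<psi> g))"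

end

theory Submission
  imports Defs
begin

text \<open>
  For \<open>p < 1\<close> a function with prescribed mean can have an arbitrarily small \<open>L_p\<close> quasi-norm:
  the Fejer kernels \<open>F_n\<close> have mean 1 and \<open>\<integral> F_n\<^sup>p \<rightarrow> 0\<close>, because they concentrate their mass near
  the origin (\<open>fejer_powr_small\<close>). On the other hand \<open>\<psi>(D)\<inverse>\<close> damps high frequencies, since
  \<open>\<alpha> > 0\<close>. Both effects are combined as follows.

  Let \<open>T\<close> be a single wave \<open>c \<cdot> wave k\<close> with \<open>k \<noteq> 0\<close>. Replace \<open>\<psi>(D) T\<close> by
  \<open>h = \<psi>(D) T \<cdot> F_n(N x_i)\<close> with one fixed coordinate \<open>x_i\<close>. Dilation by an integer \<open>N\<close> preserves
  integrals over the torus, so \<open>\<integral> |h|\<^sup>p = |c \<psi>(k)|\<^sup>p \<integral> F_n\<^sup>p\<close>, which is small for a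
  suitable \<open>n\<close>, uniformly in \<open>N\<close>. The trigonometric polynomial \<open>g = \<psi>(D)\<inverse> h\<close> differs from \<open>T\<close>
  only in the frequencies \<open>k + N m e_i\<close> with \<open>0 < |m| < n\<close>, where its coefficients are bounded by
  multiples of \<open>1 / |\<psi>(k + N m e_i)|\<close>. These tend to 0 as \<open>N \<rightarrow> \<infinity>\<close>, so \<open>g\<close> is uniformly close to
  \<open>T\<close> (\<open>weyl_negligible_wave\<close>). Functions that can be approximated in this sense are closed under
  addition, hence all trigonometric polynomials can be, and these are dense in \<open>L_q\<close> for
  \<open>q < \<infinity>\<close> and in the continuous functions for \<open>q = \<infinity>\<close>
  (\<open>exists_trigpoly_uniform_neighbourhood\<close>).

  Since \<open>weyl_derivative\<close> is a chosen representative, the uniqueness theorem for Fourier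
  coefficients (\<open>AE_eq_0_of_fourier_coeff_0\<close>) is needed to transfer the smallness of \<open>h\<close> to it.
  Uniqueness and density both come from one approximation result: bounded measurable functions
  are almost everywhere limits of uniformly bounded trigonometric polynomials
  (\<open>bounded_measurable_AE_limit_trigpoly\<close>).
\<close>

section \<open>Waves and their orthogonality on the torus\<close>

definition wave :: "int ^ 'n \<Rightarrow> real ^ 'n \<Rightarrow> complex" where
  "wave k x = cis (x \<bullet> freq k)"

lemma space_torus_measure [simp]: "space torus_measure = cbox 0 (\<chi> i. 2 * pi)"
  by (simp add: torus_measure_def)

lemma integrable_continuous_torus:
  fixes f :: "real ^ 'n \<Rightarrow> 'b::euclidean_space"
  assumes "continuous_on UNIV f"
  shows "integrable torus_measure f"
proof -
  have "f absolutely_integrable_on cbox 0 (\<chi> i. 2 * pi)"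
    by (rule absolutely_integrable_continuous) (rule continuous_on_subset[OF assms], simp)
  then show ?thesis
    unfolding torus_measure_def by (simp add: set_integrable_def integrable_restrict_space)
qed

lemma borel_measurable_continuous_torus:
  fixes f :: "real ^ 'n \<Rightarrow> 'b::euclidean_space"
  assumes "continuous_on UNIV f"
  shows "f \<in> borel_measurable torus_measure"
  using integrable_continuous_torus[OF assms] by auto

lemma finite_measure_torus: "finite_measure (torus_measure :: (real ^ 'n) measure)"
proof
  show "emeasure (torus_measure :: (real ^ 'n) measure) (space torus_measure) \<noteq> \<infinity>"
    unfolding torus_measure_def
    using emeasure_lborel_cbox_finite[of "0 :: real ^ 'n" "\<chi> i. 2 * pi"]
    by (simp add: emeasure_restrict_space)
qed

lemma continuous_wave [continuous_intros]: "continuous_on S (wave k)"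
  unfolding wave_def by (intro continuous_intros)

lemma freq_add: "freq (k + l) = freq k + freq l"
  and freq_minus: "freq (- k) = - freq k"
  and freq_0 [simp]: "freq 0 = 0"
  by (auto simp: freq_def vec_eq_iff)

lemma freq_eq_0_iff [simp]: "freq k = 0 \<longleftrightarrow> k = 0"
  by (auto simp: freq_def vec_eq_iff)

lemma wave_add: "wave (k + l) x = wave k x * wave l x"
  by (simp add: wave_def freq_add inner_add_right cis_mult)

lemma wave_0 [simp]: "wave 0 x = 1"
  by (simp add: wave_def)

lemma norm_wave [simp]: "cmod (wave k x) = 1"
  by (simp add: wave_def)

lemma wave_axis: "wave (axis i m) x = cis (of_int m * x $ i)"
proof -
  have "freq (axis i m) = axis i (of_int m :: real)"
    by (auto simp: freq_def vec_eq_iff axis_def)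
  then show ?thesis by (simp add: wave_def inner_axis mult.commute)
qed

lemma periodic_wave: "periodic (wave (k :: int ^ 'n))"
  unfolding periodic_def
proof (intro allI)
  fix x :: "real ^ 'n" and i
  have "wave k (x + axis i (2 * pi)) = wave k x * cis (2 * pi * of_int (k $ i))"
    by (simp add: wave_def inner_add_left flip: cis_mult) (simp add: inner_axis' freq_def)
  also have "cis (2 * pi * of_int (k $ i)) = 1"
    by (rule cis_multiple_2pi) auto
  finally show "wave k (x + axis i (2 * pi)) = wave k x" by simp
qed

lemma integral_cis_period:
  fixes m :: int
  shows "(\<integral>t. indicator {0..2*pi} t *\<^sub>R cis (t * of_int m) \<partial>lborel) = (if m = 0 then 2 * pi else 0)"
proof (cases "m = 0")
  case True
  then show ?thesis by (simp add: scaleR_conv_of_real)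
next
  case False
  have "(\<integral>t. indicator {0..2*pi} t *\<^sub>R cis (t * of_int m) \<partial>lborel)
      = cis (2*pi * of_int m) / (\<i> * of_int m) - cis (0 * of_int m) / (\<i> * of_int m)"
  proof (rule integral_FTC_atLeastAtMost)
    fix t :: real
    have "((\<lambda>z. exp (\<i> * (z * of_int m)) / (\<i> * of_int m)) has_field_derivative
        exp (\<i> * (of_real t * of_int m))) (at (of_real t))"
      using False by (auto intro!: derivative_eq_intros simp: field_simps)
    from has_vector_derivative_real_field[OF this]
    show "((\<lambda>t. cis (t * of_int m) / (\<i> * of_int m)) has_vector_derivative
        cis (t * of_int m)) (at t within {0..2*pi})"
      by (simp add: cis_conv_exp)
  qed (auto intro!: continuous_intros)
  also have "cis (2 * pi * of_int m) = 1"
    by (rule cis_multiple_2pi) auto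
  finally show ?thesis using False by simp
qed

text \<open>
  Over the cube the integral of a wave splits into a product of one-dimensional integrals
  over a full period of \<open>cis\<close>, and a non-zero component of \<open>k\<close> makes its factor vanish.
\<close>

lemma integral_wave:
  fixes k :: "int ^ 'n"
  shows "integral\<^sup>L torus_measure (wave k) = (if k = 0 then of_real ((2 * pi) ^ CARD('n)) else 0)"
proof -
  interpret product_sigma_finite "\<lambda>_. lborel :: real measure" ..
  let ?Q = "cbox 0 (\<chi> i. 2 * pi) :: (real ^ 'n) set"
  define u where "u b t = (indicator {0..2*pi} t *\<^sub>R cis (t * (freq k \<bullet> b)) :: complex)" for b t
  have u: "indicator ?Q x *\<^sub>R wave k x = (\<Prod>b\<in>Basis. u b (x \<bullet> b))" for x
  proof -
    have Q: "x \<in> ?Q \<longleftrightarrow> (\<forall>b\<in>Basis. x \<bullet> b \<in> {0..2*pi})"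
      by (auto simp: mem_box Basis_vec_def inner_axis)
    have c: "(\<Prod>b\<in>Basis. cis (x \<bullet> b * (freq k \<bullet> b))) = wave k x"
      unfolding wave_def euclidean_inner[of x "freq k"]
      by (induction rule: finite_induct[OF finite_Basis]) (auto simp: cis_mult)
    show ?thesis
    proof (cases "x \<in> ?Q")
      case True
      with Q show ?thesis by (simp add: u_def c[symmetric])
    next
      case False
      with Q obtain b where "b \<in> Basis" "x \<bullet> b \<notin> {0..2*pi}" by auto
      then have "(\<Prod>b\<in>Basis. u b (x \<bullet> b)) = 0"
        by (intro prod_zero bexI[of _ b]) (auto simp: u_def)
      with False show ?thesis by simp
    qed
  qed
  have ui: "integrable lborel (u b)" for b
    unfolding u_def by (intro borel_integrable_compact continuous_intros) auto
  have meas [measurable]: "wave k \<in> borel_measurable borel"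
    by (intro borel_measurable_continuous_onI continuous_intros)
  have [measurable]: "u b \<in> borel_measurable borel" for b
    using ui[of b] by auto
  have "integral\<^sup>L torus_measure (wave k) = (\<integral>x. indicator ?Q x *\<^sub>R wave k x \<partial>lebesgue)"
    by (simp add: torus_measure_def integral_restrict_space)
  also have "\<dots> = (\<integral>x. indicator ?Q x *\<^sub>R wave k x \<partial>lborel)"
    by (intro integral_completion) measurable
  also have "\<dots> = (\<integral>x. (\<Prod>b\<in>Basis. u b (x \<bullet> b)) \<partial>lborel)"
    by (simp add: u)
  also have "\<dots> = (\<integral>x. (\<Prod>b\<in>Basis. u b (x b)) \<partial>(\<Pi>\<^sub>M b\<in>(Basis :: (real ^ 'n) set). lborel))"
    by (subst lborel_eq, subst integral_distr) (auto)
  also have "\<dots> = (\<Prod>b\<in>(Basis :: (real ^ 'n) set). \<integral>t. u b t \<partial>lborel)"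
    by (intro product_integral_prod ui finite_Basis)
  also have "\<dots> = (\<Prod>i\<in>UNIV. \<integral>t. u (axis i 1) t \<partial>lborel)"
  proof -
    have "(Basis :: (real ^ 'n) set) = (\<lambda>i. axis i 1) ` UNIV"
      by (auto simp: Basis_vec_def)
    moreover have "inj_on (\<lambda>i. axis i (1::real) :: real ^ 'n) UNIV"
      by (simp add: inj_on_def axis_eq_axis)
    ultimately have "(\<Prod>b\<in>Basis. g b) = (\<Prod>i\<in>UNIV. g (axis i 1))" for g :: "real ^ 'n \<Rightarrow> complex"
      by (metis (no_types, lifting) prod.reindex_cong)
    then show ?thesis .
  qed
  also have "\<dots> = (\<Prod>i\<in>UNIV. if k $ i = 0 then 2 * pi else 0)"
    unfolding u_def using integral_cis_period by (simp add: inner_axis freq_def)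
  also have "\<dots> = (if k = 0 then of_real ((2 * pi) ^ CARD('n)) else 0)"
    by (auto simp: vec_eq_iff)
  finally show ?thesis .
qed

section \<open>Trigonometric polynomials\<close>

text \<open>
  The inductive form, with repeated frequencies allowed, turns linear statements into an
  induction with one step for a wave and one for a sum.
\<close>

inductive trigpoly :: "(real ^ 'n \<Rightarrow> complex) \<Rightarrow> bool" where
  monomial: "trigpoly (\<lambda>x. c * wave k x)"
| add: "trigpoly f \<Longrightarrow> trigpoly g \<Longrightarrow> trigpoly (\<lambda>x. f x + g x)"

lemma trigpoly_const: "trigpoly (\<lambda>x. c)"
  using trigpoly.monomial[of c 0] by simp

lemma trigpoly_mult:
  assumes "trigpoly f" "trigpoly g"
  shows "trigpoly (\<lambda>x. f x * g x)"
  using assms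
proof (induction f)
  case (monomial c k)
  from \<open>trigpoly g\<close> show ?case
  proof induction
    case (monomial d l)
    have "(\<lambda>x. c * wave k x * (d * wave l x)) = (\<lambda>x. (c * d) * wave (k + l) x)"
      by (simp add: wave_add mult_ac)
    then show ?case by (simp only: trigpoly.monomial)
  next
    case (add f g)
    then show ?case by (simp add: distrib_left trigpoly.add)
  qed
next
  case (add f h)
  then show ?case by (simp add: distrib_right trigpoly.add)
qed

lemma trigpoly_sum:
  "finite A \<Longrightarrow> (\<And>a. a \<in> A \<Longrightarrow> trigpoly (f a)) \<Longrightarrow> trigpoly (\<lambda>x. \<Sum>a\<in>A. f a x)"
  by (induction rule: finite_induct) (auto intro: trigpoly_const trigpoly.add)

lemma continuous_trigpoly: "trigpoly f \<Longrightarrow> continuous_on UNIV f"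
  by (induction rule: trigpoly.induct) (auto intro!: continuous_intros)

text \<open>
  The torus as a compact subset of a complex Euclidean space. Trigonometric polynomials are the
  restrictions of ordinary polynomials in the real and imaginary parts of the coordinates, so
  the polynomial version of the Stone-Weierstrass theorem applies.
\<close>

definition torus_point :: "real ^ 'n \<Rightarrow> complex ^ 'n" where
  "torus_point x = (\<chi> i. cis (x $ i))"

lemma continuous_torus_point: "continuous_on S torus_point"
  unfolding torus_point_def by (intro continuous_intros)

lemma trigpoly_coordinate:
  assumes "b \<in> Basis"
  shows "trigpoly (\<lambda>x. of_real (torus_point x \<bullet> b))"
proof -
  obtain i u where b: "b = axis i u" and u: "u \<in> {1, \<i>}"
    using assms by (auto simp: Basis_vec_def Basis_complex_def)
  have w: "wave (axis i 1) x = cis (x $ i)" "wave (axis i (- 1)) x = cis (- (x $ i))" for x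
    by (simp_all add: wave_axis)
  have "(\<lambda>x. of_real (torus_point x \<bullet> b)) =
      (\<lambda>x. (if u = 1 then 1/2 else - \<i>/2) * wave (axis i 1) x
         + (if u = 1 then 1/2 else \<i>/2) * wave (axis i (- 1)) x)"
    using u by (auto simp: b torus_point_def inner_axis w inner_complex_def complex_eq_iff fun_eq_iff)
  then show ?thesis by (simp only: trigpoly.intros)
qed

lemma trigpoly_real_polynomial:
  assumes "real_polynomial_function r"
  shows "trigpoly (\<lambda>x. of_real (r (torus_point x)))"
  using assms
proof induction
  case (linear r)
  interpret r: bounded_linear r by fact
  have "r z = (\<Sum>b\<in>Basis. (z \<bullet> b) * r b)" for z
  proof -
    have "r z = r (\<Sum>b\<in>Basis. (z \<bullet> b) *\<^sub>R b)"
      by (simp add: euclidean_representation)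
    then show ?thesis by (simp only: r.sum r.scaleR real_scaleR_def)
  qed
  then have "(\<lambda>x. of_real (r (torus_point x))) =
      (\<lambda>x. \<Sum>b\<in>Basis. complex_of_real (torus_point x \<bullet> b) * of_real (r b))"
    by (metis (no_types, lifting) of_real_mult of_real_sum sum.cong)
  then show ?case
    by (auto intro!: trigpoly_sum trigpoly_mult trigpoly_coordinate trigpoly_const)
qed (auto intro: trigpoly_const trigpoly.add trigpoly_mult)

lemma range_torus_point: "torus_point ` cbox 0 (\<chi> i :: 'n::finite. 2 * pi) = range torus_point"
proof -
  have "torus_point x \<in> torus_point ` cbox 0 (\<chi> i. 2 * pi)" for x :: "real ^ 'n"
  proof (rule image_eqI)
    let ?y = "(\<chi> i. 2 * pi * frac (x $ i / (2 * pi))) :: real ^ 'n"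
    show "?y \<in> cbox 0 (\<chi> i. 2 * pi)"
      by (auto simp: mem_box_cart frac_lt_1 less_imp_le)
    have "cis (x $ i) = cis (?y $ i)" for i
    proof -
      have "x $ i = 2 * pi * frac (x $ i / (2 * pi)) + 2 * pi * of_int \<lfloor>x $ i / (2 * pi)\<rfloor>"
        by (simp add: frac_def field_simps)
      then have "cis (x $ i) = cis (?y $ i) * cis (2 * pi * of_int \<lfloor>x $ i / (2 * pi)\<rfloor>)"
        unfolding cis_mult by simp
      also have "cis (2 * pi * of_int \<lfloor>x $ i / (2 * pi)\<rfloor>) = 1"
        by (rule cis_multiple_2pi) auto
      finally show ?thesis by simp
    qed
    then show "torus_point x = torus_point ?y"
      by (simp add: torus_point_def vec_eq_iff)
  qed
  then show ?thesis by auto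
qed

lemma trigpoly_dense_torus_point:
  fixes U :: "complex ^ 'n \<Rightarrow> complex"
  assumes U: "continuous_on (range torus_point) U" and "0 < \<epsilon>"
  obtains T where "trigpoly T" "\<And>x. cmod (U (torus_point x) - T x) < \<epsilon>"
proof -
  have "compact (torus_point ` cbox 0 (\<chi> i :: 'n. 2 * pi))"
    by (intro compact_continuous_image continuous_torus_point compact_cbox)
  then have "compact (range torus_point :: (complex ^ 'n) set)"
    by (simp only: range_torus_point)
  from Stone_Weierstrass_polynomial_function[OF this U \<open>0 < \<epsilon>\<close>]
  obtain g where g: "polynomial_function g"
    "\<And>z. z \<in> range torus_point \<Longrightarrow> cmod (U z - g z) < \<epsilon>" by blast
  define T where "T x = g (torus_point x)" for x
  have "real_polynomial_function (Re \<circ> g)" "real_polynomial_function (Im \<circ> g)"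
    using g(1) by (auto simp: polynomial_function_def bounded_linear_Re bounded_linear_Im)
  note this[THEN trigpoly_real_polynomial]
  moreover have "T = (\<lambda>x. of_real ((Re \<circ> g) (torus_point x)) + \<i> * of_real ((Im \<circ> g) (torus_point x)))"
    by (auto simp: T_def complex_eq)
  ultimately have "trigpoly T"
    by (auto intro!: trigpoly.add trigpoly_mult trigpoly_const)
  with g(2) show thesis by (intro that[of T]) (auto simp: T_def)
qed

text \<open>
  Identifying opposite faces makes \<open>torus_point\<close> a quotient map from the compact cube onto the
  torus, so a function that is constant on its fibres descends to a continuous function there.
\<close>

lemma trigpoly_dense_cube:
  fixes u :: "real ^ 'n \<Rightarrow> complex"
  assumes u: "continuous_on (cbox 0 (\<chi> i. 2 * pi)) u" and "0 < \<epsilon>"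
    and fibres: "\<And>x y. x \<in> cbox 0 (\<chi> i. 2 * pi) \<Longrightarrow> y \<in> cbox 0 (\<chi> i. 2 * pi) \<Longrightarrow>
      torus_point x = torus_point y \<Longrightarrow> u x = u y"
  obtains T where "trigpoly T"
    "\<And>x. x \<in> cbox 0 (\<chi> i. 2 * pi) \<Longrightarrow> cmod (u x - T x) < \<epsilon>"
proof -
  let ?Q = "cbox 0 (\<chi> i. 2 * pi) :: (real ^ 'n) set"
  define U where "U = u \<circ> inv_into ?Q torus_point"
  have Uu: "U (torus_point x) = u x" if "x \<in> ?Q" for x
  proof -
    have "torus_point x \<in> torus_point ` ?Q" using that by (rule imageI)
    then show ?thesis
      unfolding U_def o_def using that
      by (intro fibres inv_into_into f_inv_into_f)
  qed
  have "continuous_on (torus_point ` ?Q) U"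
    unfolding continuous_on_closed_invariant
  proof (intro allI impI)
    fix B :: "complex set"
    assume "closed B"
    have "closed (?Q \<inter> u -` B)"
      by (rule continuous_closed_preimage[OF u closed_cbox \<open>closed B\<close>])
    then have "compact (?Q \<inter> (?Q \<inter> u -` B))"
      by (intro compact_Int_closed compact_cbox)
    then have "closed (torus_point ` (?Q \<inter> u -` B))"
      by (intro compact_imp_closed compact_continuous_image continuous_torus_point) (simp add: Int_absorb1 flip: Int_assoc)
      
    moreover have "torus_point ` (?Q \<inter> u -` B) \<inter> torus_point ` ?Q = U -` B \<inter> torus_point ` ?Q"
      using Uu by auto
    ultimately show "\<exists>A. closed A \<and> A \<inter> torus_point ` ?Q = U -` B \<inter> torus_point ` ?Q" by blast
  qed
  then have "continuous_on (range torus_point) U"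
    by (simp only: range_torus_point)
  from trigpoly_dense_torus_point[OF this \<open>0 < \<epsilon>\<close>]
  obtain T where "trigpoly T" "\<And>x. cmod (U (torus_point x) - T x) < \<epsilon>" by blast
  with Uu show thesis by (metis that)
qed

lemma torus_point_eq_on_cube:
  assumes "x \<in> cbox 0 (\<chi> i. 2 * pi)" "y \<in> cbox 0 (\<chi> i. 2 * pi)" "torus_point x = torus_point y"
  shows "x $ i = y $ i \<or> (x $ i = 0 \<and> y $ i = 2 * pi) \<or> (x $ i = 2 * pi \<and> y $ i = 0)"
proof -
  have b: "0 \<le> x $ i" "x $ i \<le> 2 * pi" "0 \<le> y $ i" "y $ i \<le> 2 * pi"
    using assms(1,2) by (auto simp: mem_box_cart)
  have "cis (x $ i) = cis (y $ i)"
    using assms(3) by (simp add: torus_point_def vec_eq_iff)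
  then have "sin (x $ i) = sin (y $ i) \<and> cos (x $ i) = cos (y $ i)"
    by (simp add: complex_eq_iff)
  then obtain m :: int where m: "x $ i = y $ i + 2 * pi * m"
    unfolding sin_cos_eq_iff by blast
  have "\<bar>of_int m * (2 * pi)\<bar> \<le> 1 * (2 * pi)"
    using b unfolding m mult.commute[of "2 * pi"] by linarith
  then have "\<bar>of_int m :: real\<bar> \<le> 1"
    unfolding abs_mult using pi_gt_zero by (simp add: mult_le_cancel_right)
  then have "m = 0 \<or> m = 1 \<or> m = -1" by linarith
  with m b show ?thesis by auto
qed

lemma periodic_shift:
  assumes "periodic f" "finite S"
  shows "f (x + (\<Sum>i\<in>S. axis i (2 * pi))) = f x"
  using assms(2)
proof induction
  case (insert i S)
  have "x + (\<Sum>i\<in>insert i S. axis i (2 * pi)) = (x + (\<Sum>i\<in>S. axis i (2 * pi))) + axis i (2 * pi)"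
    using insert by (simp add: add_ac)
  then show ?case
    using assms(1) insert.IH by (simp only: periodic_def)
qed simp

text \<open>
  Two points of the cube over the same torus point differ by \<open>2\<pi>\<close> exactly in those coordinates in
  which one lies on the lower and the other on the upper face. Adding \<open>2\<pi>\<close> to the lower one
  in each of these coordinates leads to a common point.
\<close>

lemma periodic_fibre:
  fixes f :: "real ^ 'n \<Rightarrow> complex"
  assumes "periodic f" "x \<in> cbox 0 (\<chi> i. 2 * pi)" "y \<in> cbox 0 (\<chi> i. 2 * pi)"
    "torus_point x = torus_point y"
  shows "f x = f y"
proof -
  define A where "A = {i. x $ i < y $ i}"
  define B where "B = {i. y $ i < x $ i}"
  have s: "(\<Sum>i\<in>S. axis i (2 * pi)) $ j = (if j \<in> S then 2 * pi else 0)" for S and j :: 'n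
    by (simp add: axis_def)
  have "x + (\<Sum>i\<in>A. axis i (2 * pi)) = y + (\<Sum>i\<in>B. axis i (2 * pi))"
    unfolding vec_eq_iff
  proof
    fix i
    from torus_point_eq_on_cube[OF assms(2-4), of i]
    show "(x + (\<Sum>i\<in>A. axis i (2 * pi))) $ i = (y + (\<Sum>i\<in>B. axis i (2 * pi))) $ i"
      by (auto simp: s A_def B_def simp del: sum_component)
  qed
  then show ?thesis
    using periodic_shift[OF assms(1)] by (metis finite)
qed

section \<open>Almost everywhere approximation by bounded trigonometric polynomials\<close>

lemma bounded_trigpoly: "trigpoly T \<Longrightarrow> \<exists>C\<ge>0. \<forall>x. cmod (T x) \<le> C"
proof (induction rule: trigpoly.induct)
  case (monomial c k)
  then show ?case by (intro exI[of _ "cmod c"]) (auto simp: norm_mult)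
next
  case (add f g)
  then obtain C D where "C \<ge> 0" "\<And>x. cmod (f x) \<le> C" "D \<ge> 0" "\<And>x. cmod (g x) \<le> D" by blast
  then show ?case by (intro exI[of _ "C + D"]) (auto intro: norm_triangle_le add_mono)
qed

lemma AE_torus_negligible:
  assumes "negligible N" "\<And>x. x \<in> cbox 0 (\<chi> i. 2 * pi) \<Longrightarrow> x \<notin> N \<Longrightarrow> P x"
  shows "AE x in torus_measure. P x"
  unfolding torus_measure_def
  using assms by (subst AE_restrict_space_iff)
    (auto simp: negligible_iff_null_sets intro!: AE_I'[of N])

text \<open>
  These factors vanish exactly on the faces of the cube. They serve as a cutoff near the
  boundary and as the denominator of the Fejer kernel.
\<close>

lemma AE_torus_sin_half_nonzero:
  "AE x in (torus_measure :: (real ^ 'n) measure). \<forall>i. sin (x $ i / 2) \<noteq> 0"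
proof (rule AE_torus_negligible)
  let ?N = "(\<Union>i. {x :: real ^ 'n. axis i 1 \<bullet> x = 0}) \<union> (\<Union>i. {x. axis i 1 \<bullet> x = 2 * pi})"
  show "negligible ?N"
    by (intro negligible_Un negligible_Union_nat negligible_Union finite_imageI) (auto intro!: negligible_hyperplane)
  fix x :: "real ^ 'n"
  assume x: "x \<in> cbox 0 (\<chi> i. 2 * pi)" "x \<notin> ?N"
  show "\<forall>i. sin (x $ i / 2) \<noteq> 0"
  proof
    fix i
    have "0 \<le> x $ i" "x $ i \<le> 2 * pi" "x $ i \<noteq> 0" "x $ i \<noteq> 2 * pi"
      using x by (auto simp: mem_box_cart inner_axis')
    then have "0 < x $ i / 2" "x $ i / 2 < pi" by auto
    then show "sin (x $ i / 2) \<noteq> 0" using sin_gt_zero by fastforce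
  qed
qed

text \<open>
  A measurable function is an almost everywhere limit of continuous functions. Projecting those
  onto the disc of radius \<open>M\<close> keeps them bounded and does not change the limit. Multiplying by
  a cutoff that vanishes on the faces makes them compatible with the identification of opposite
  faces, and Stone-Weierstrass replaces them by trigonometric polynomials up to an error of
  \<open>1 / (n + 1)\<close>, which accounts for the bound \<open>M + 1\<close>.
\<close>

lemma bounded_measurable_AE_limit_trigpoly:
  fixes s :: "real ^ 'n \<Rightarrow> complex"
  assumes s: "s \<in> borel_measurable torus_measure" and M: "\<And>x. cmod (s x) \<le> M"
  obtains T where "\<And>n :: nat. trigpoly (T n)"
    "\<And>n x. x \<in> cbox 0 (\<chi> i. 2 * pi) \<Longrightarrow> cmod (T n x) \<le> M + 1"
    "AE x in torus_measure. (\<lambda>n. T n x) \<longlonglongrightarrow> s x"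
proof -
  let ?Q = "cbox 0 (\<chi> i. 2 * pi) :: (real ^ 'n) set"
  have M0: "0 \<le> M" using M[of 0] norm_ge_zero order_trans by blast
  have "s measurable_on ?Q"
    using s by (simp add: measurable_on_iff_borel_measurable torus_measure_def)
  then obtain N g where N: "negligible N" and g: "\<And>n :: nat. continuous_on UNIV (g n)"
    and lim: "\<And>x. x \<notin> N \<Longrightarrow> (\<lambda>n. g n x) \<longlonglongrightarrow> (if x \<in> ?Q then s x else 0)"
    unfolding measurable_on_def by blast
  define clip where "clip = closest_point (cball (0 :: complex) M)"
  have clip_cont: "continuous_on S clip" for S
    unfolding clip_def using M0 by (intro continuous_on_closest_point) auto
  have clip_le: "cmod (clip z) \<le> M" for z
    using closest_point_in_set[of "cball (0 :: complex) M" z] M0 by (auto simp: clip_def)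
  define cutoff where "cutoff n x = min 1 (real n * (\<Prod>i\<in>UNIV. \<bar>sin (x $ i / 2)\<bar>))"
    for n and x :: "real ^ 'n"
  have cutoff01: "0 \<le> cutoff n x" "cutoff n x \<le> 1" for n x
    by (auto simp: cutoff_def intro!: mult_nonneg_nonneg prod_nonneg)
  define u where "u n x = of_real (cutoff n x) * clip (g n x)" for n x
  have u_cont: "continuous_on ?Q (u n)" for n
    unfolding u_def cutoff_def
    by (intro continuous_intros continuous_on_compose2[OF clip_cont[of UNIV]]
        continuous_on_subset[OF g]) auto
  have u_le: "cmod (u n x) \<le> M" for n x
    using mult_mono[OF cutoff01(2) clip_le] cutoff01(1) by (simp add: u_def norm_mult)
  have u_fibre: "u n x = u n y" if "x \<in> ?Q" "y \<in> ?Q" "torus_point x = torus_point y" for n x y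
  proof (cases "x = y")
    case False
    then obtain i where "x $ i \<noteq> y $ i" by (auto simp: vec_eq_iff)
    with torus_point_eq_on_cube[OF that, of i]
    have "sin (x $ i / 2) = 0" "sin (y $ i / 2) = 0" by auto
    then have "(\<Prod>i\<in>UNIV. \<bar>sin (x $ i / 2)\<bar>) = 0" "(\<Prod>i\<in>UNIV. \<bar>sin (y $ i / 2)\<bar>) = 0"
      by (auto intro!: bexI[of _ i])
    then have "cutoff n x = 0" "cutoff n y = 0"
      by (simp_all only: cutoff_def)
    then show ?thesis by (simp add: u_def)
  qed simp
  have "\<exists>T. trigpoly T \<and> (\<forall>x\<in>?Q. cmod (u n x - T x) < inverse (Suc n))" for n
    using trigpoly_dense_cube[OF u_cont _ u_fibre, of "inverse (real (Suc n))" n]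
    by (metis inverse_positive_iff_positive of_nat_0_less_iff zero_less_Suc)
  then obtain T where T: "\<And>n. trigpoly (T n)"
    and Tu: "\<And>n x. x \<in> ?Q \<Longrightarrow> cmod (u n x - T n x) < inverse (Suc n)"
    by metis
  show thesis
  proof
    show "trigpoly (T n)" for n by (rule T)
    show "cmod (T n x) \<le> M + 1" if "x \<in> ?Q" for n x
    proof -
      have "cmod (T n x) \<le> cmod (u n x) + cmod (u n x - T n x)"
        using norm_triangle_sub[of "T n x" "u n x"] by (simp add: norm_minus_commute)
      also have "\<dots> \<le> M + inverse (Suc n)"
        using u_le Tu[OF that] by (meson add_mono less_imp_le)
      also have "inverse (real (Suc n)) \<le> 1" by (simp add: inverse_le_1_iff)
      finally show ?thesis by simp
    qed
    have "AE x in torus_measure. x \<in> ?Q"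
      using AE_space[of "torus_measure :: (real ^ 'n) measure"] by simp
    moreover have "AE x in torus_measure. x \<notin> N"
      using N by (rule AE_torus_negligible)
    ultimately show "AE x in torus_measure. (\<lambda>n. T n x) \<longlonglongrightarrow> s x"
      using AE_torus_sin_half_nonzero
    proof eventually_elim
      case (elim x)
      have "(\<lambda>n. clip (g n x)) \<longlonglongrightarrow> clip (s x)"
        using lim[of x] elim
        by (intro continuous_on_tendsto_compose[OF clip_cont[of UNIV]]) auto
      moreover have "clip (s x) = s x"
        unfolding clip_def using M by (intro closest_point_self) auto
      moreover have "(\<lambda>n. cutoff n x) \<longlonglongrightarrow> 1"
      proof -
        have "(\<Prod>i\<in>UNIV. \<bar>sin (x $ i / 2)\<bar>) > 0"
          using elim by (intro prod_pos) auto
        then obtain m :: nat where m: "1 < real m * (\<Prod>i\<in>UNIV. \<bar>sin (x $ i / 2)\<bar>)"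
          using reals_Archimedean3 by blast
        have "cutoff n x = 1" if "n \<ge> m" for n
        proof -
          have "real m * (\<Prod>i\<in>UNIV. \<bar>sin (x $ i / 2)\<bar>) \<le> real n * (\<Prod>i\<in>UNIV. \<bar>sin (x $ i / 2)\<bar>)"
            using that by (intro mult_right_mono prod_nonneg) auto
          with m show ?thesis unfolding cutoff_def by linarith
        qed
        then show ?thesis
          by (intro tendsto_eventually eventually_sequentiallyI[of m])
      qed
      ultimately have "(\<lambda>n. u n x) \<longlonglongrightarrow> of_real 1 * s x"
        unfolding u_def by (intro tendsto_intros) auto
      moreover have "(\<lambda>n. u n x - T n x) \<longlonglongrightarrow> 0"
        using Tu elim by (intro Lim_null_comparison[OF _ LIMSEQ_inverse_real_of_nat])
          (auto intro!: always_eventually less_imp_le)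
      ultimately have "(\<lambda>n. u n x - (u n x - T n x)) \<longlonglongrightarrow> of_real 1 * s x - 0"
        by (intro tendsto_diff)
      then show ?case by simp
    qed
  qed
qed

section \<open>Uniqueness of Fourier coefficients\<close>

lemma fourier_coeff_wave:
  "fourier_coeff f k = (\<integral>x. f x * wave (- k) x \<partial>torus_measure) / of_real ((2 * pi) ^ CARD('n))"
  for k :: "int ^ 'n"
  by (simp add: fourier_coeff_def wave_def freq_minus cis_conv_exp)

lemma integrable_mult_trigpoly:
  assumes h: "integrable torus_measure h" and T: "trigpoly T"
  shows "integrable torus_measure (\<lambda>x. h x * T x)"
proof -
  from bounded_trigpoly[OF T] obtain C where C: "\<And>x. cmod (T x) \<le> C" by blast
  have [measurable]: "h \<in> borel_measurable torus_measure" "T \<in> borel_measurable torus_measure"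
    using h continuous_trigpoly[OF T] by (auto intro: borel_measurable_continuous_torus)
  show ?thesis
  proof (rule Bochner_Integration.integrable_bound)
    show "integrable torus_measure (\<lambda>x. of_real C * h x)" using h by simp
    show "AE x in torus_measure. cmod (h x * T x) \<le> norm (of_real C * h x)"
      using C by (intro AE_I2) (auto simp: norm_mult mult.commute intro!: mult_right_mono order_trans[OF _ abs_ge_self])
  qed measurable
qed

lemma integral_mult_trigpoly_eq_0:
  assumes h: "integrable torus_measure h" and 0: "\<And>k. fourier_coeff h k = 0" and T: "trigpoly T"
  shows "(\<integral>x. h x * T x \<partial>torus_measure) = 0"
  using T
proof induction
  case (monomial c k)
  have "(\<integral>x. h x * wave k x \<partial>torus_measure) = 0"
    using 0[of "- k"] by (simp add: fourier_coeff_wave)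
  then have "(\<integral>x. c * (h x * wave k x) \<partial>torus_measure) = 0" by simp
  then show ?case by (simp only: mult.left_commute)
next
  case (add f g)
  then show ?case by (simp add: distrib_left integrable_mult_trigpoly h)
qed

text \<open>
  If all coefficients of \<open>h\<close> vanish, then \<open>h\<close> is orthogonal to all trigonometric polynomials, hence
  by dominated convergence to every bounded measurable function; the conjugate sign of \<open>h\<close>
  gives \<open>\<integral> |h| = 0\<close>.
\<close>

lemma AE_eq_0_of_fourier_coeff_0:
  fixes h :: "real ^ 'n \<Rightarrow> complex"
  assumes h: "integrable torus_measure h" and 0: "\<And>k. fourier_coeff h k = 0"
  shows "AE x in torus_measure. h x = 0"
proof -
  have [measurable]: "h \<in> borel_measurable torus_measure" using h by simp
  \<comment> \<open>Then \<open>h s = |h|\<close>.\<close>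
  define s where "s x = cnj (sgn (h x))" for x
  have "continuous_on UNIV cnj" by (intro continuous_intros)
  then have [measurable]: "cnj \<in> borel_measurable borel" by (rule borel_measurable_continuous_onI)
  have s: "s \<in> borel_measurable torus_measure" unfolding s_def by measurable
  have "cmod (s x) \<le> 1" for x by (simp add: s_def norm_sgn)
  from bounded_measurable_AE_limit_trigpoly[OF s this]
  obtain T where T: "\<And>n :: nat. trigpoly (T n)"
    "\<And>n x. x \<in> cbox 0 (\<chi> i. 2 * pi) \<Longrightarrow> cmod (T n x) \<le> 1 + 1"
    "AE x in torus_measure. (\<lambda>n. T n x) \<longlonglongrightarrow> s x" by blast
  have "(\<lambda>n. \<integral>x. h x * T n x \<partial>torus_measure) \<longlonglongrightarrow> (\<integral>x. h x * s x \<partial>torus_measure)"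
  proof (rule integral_dominated_convergence)
    show "integrable torus_measure (\<lambda>x. 2 * cmod (h x))" using h by simp
    show "AE x in torus_measure. cmod (h x * T n x) \<le> 2 * cmod (h x)" for n
      using T(2)[of _ n] by (intro AE_I2) (auto simp: norm_mult mult.commute[of _ "cmod (h _)"] intro!: mult_left_mono)
    show "AE x in torus_measure. (\<lambda>n. h x * T n x) \<longlonglongrightarrow> h x * s x"
      using T(3) by eventually_elim (intro tendsto_intros)
    show "(\<lambda>x. h x * T n x) \<in> borel_measurable torus_measure" for n
      using integrable_mult_trigpoly[OF h T(1)] by auto
  qed (use s in measurable)
  then have "(\<integral>x. h x * s x \<partial>torus_measure) = 0"
    by (simp add: integral_mult_trigpoly_eq_0[OF h 0 T(1)] LIMSEQ_const_iff)
  moreover have "h x * s x = of_real (cmod (h x))" for x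
    by (simp add: s_def sgn_div_norm scaleR_conv_of_real complex_norm_square[symmetric] field_simps power2_eq_square)
  ultimately have "(\<integral>x. cmod (h x) \<partial>torus_measure) = 0"
    by simp
  then show ?thesis
    using h by (subst (asm) integral_nonneg_eq_0_iff_AE) auto
qed

section \<open>Density of trigonometric polynomials\<close>

text \<open>
  A crude substitute for the triangle inequality that is valid for every positive exponent,
  below and above 1.
\<close>

lemma powr_add_le:
  fixes a b r :: real
  assumes "0 \<le> a" "0 \<le> b" "0 < r"
  shows "(a + b) powr r \<le> 2 powr r * (a powr r + b powr r)"
proof -
  have "(a + b) powr r \<le> (2 * max a b) powr r"
    using assms by (intro powr_mono2) auto
  also have "\<dots> = 2 powr r * max a b powr r"
    using assms by (intro powr_mult) 
  also have "max a b powr r \<le> a powr r + b powr r"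
    by (auto simp: max_def)
  finally show ?thesis by simp
qed

lemma powr_norm_add_le:
  fixes a b :: complex
  assumes "0 < r"
  shows "cmod (a + b) powr r \<le> 2 powr r * (cmod a powr r + cmod b powr r)"
  using powr_add_le[of "cmod a" "cmod b" r] assms
  by (smt (verit) norm_ge_zero norm_triangle_ineq powr_mono2)

lemma nn_integral_powr_norm_triangle:
  fixes f g h :: "'a \<Rightarrow> complex"
  assumes [measurable]: "f \<in> borel_measurable M" "g \<in> borel_measurable M" "h \<in> borel_measurable M"
    and r: "0 < r"
  shows "(\<integral>\<^sup>+ x. ennreal (cmod (f x - h x) powr r) \<partial>M) \<le>
    ennreal (2 powr r) * ((\<integral>\<^sup>+ x. ennreal (cmod (f x - g x) powr r) \<partial>M)
      + (\<integral>\<^sup>+ x. ennreal (cmod (g x - h x) powr r) \<partial>M))"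
proof -
  have "(\<integral>\<^sup>+ x. ennreal (cmod (f x - h x) powr r) \<partial>M) \<le>
      (\<integral>\<^sup>+ x. ennreal (2 powr r) * (ennreal (cmod (f x - g x) powr r) + ennreal (cmod (g x - h x) powr r)) \<partial>M)"
  proof (intro nn_integral_mono)
    fix x
    have "cmod (f x - h x) powr r \<le> 2 powr r * (cmod (f x - g x) powr r + cmod (g x - h x) powr r)"
      using powr_norm_add_le[OF r, of "f x - g x" "g x - h x"] by simp
    then show "ennreal (cmod (f x - h x) powr r) \<le>
        ennreal (2 powr r) * (ennreal (cmod (f x - g x) powr r) + ennreal (cmod (g x - h x) powr r))"
      by (simp add: ennreal_leI flip: ennreal_mult ennreal_plus)
  qed
  also have "\<dots> = ennreal (2 powr r) * ((\<integral>\<^sup>+ x. ennreal (cmod (f x - g x) powr r) \<partial>M)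
      + (\<integral>\<^sup>+ x. ennreal (cmod (g x - h x) powr r) \<partial>M))"
    by (simp add: nn_integral_cmult nn_integral_add)
  finally show ?thesis .
qed

lemma tendsto_powr_norm_diff_0:
  fixes a :: complex
  assumes "X \<longlonglongrightarrow> a" "0 < r"
  shows "(\<lambda>n. ennreal (cmod (a - X n) powr r)) \<longlonglongrightarrow> 0"
proof -
  have "(\<lambda>n. cmod (a - X n)) \<longlonglongrightarrow> 0"
    using tendsto_norm[OF tendsto_diff[OF tendsto_const assms(1)], of a] by simp
  from tendsto_powr'[OF this tendsto_const, of r] assms(2)
  have "(\<lambda>n. cmod (a - X n) powr r) \<longlonglongrightarrow> 0" by simp
  then show ?thesis by (metis ennreal_0 tendsto_ennrealI)
qed

text \<open>
  Truncation reduces the claim to a bounded function, for which the almost everywhere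
  approximation and dominated convergence apply. Working with the \<open>r\<close>-th power of the
  quasi-norm treats \<open>r < 1\<close> and \<open>r \<ge> 1\<close> alike.
\<close>

lemma trigpoly_dense_powr:
  fixes f :: "real ^ 'n \<Rightarrow> complex"
  assumes [measurable]: "f \<in> borel_measurable torus_measure" and r: "0 < r"
    and fin: "(\<integral>\<^sup>+ x. ennreal (cmod (f x) powr r) \<partial>torus_measure) < \<infinity>" and \<epsilon>: "0 < \<epsilon>"
  obtains T where "trigpoly T" "(\<integral>\<^sup>+ x. ennreal (cmod (f x - T x) powr r) \<partial>torus_measure) \<le> ennreal \<epsilon>"
proof -
  let ?I = "\<lambda>f. \<integral>\<^sup>+ x. ennreal (cmod (f x) powr r) \<partial>(torus_measure :: (real ^ 'n) measure)"
  interpret finite_measure "torus_measure :: (real ^ 'n) measure" by (rule finite_measure_torus)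
  define \<eta> where "\<eta> = ennreal (\<epsilon> / (2 * 2 powr r))"
  have \<eta>: "0 < \<eta>" using \<epsilon> by (simp add: \<eta>_def)
  define tr where "tr m x = (if cmod (f x) \<le> real m then f x else 0)" for m x
  have [measurable]: "tr m \<in> borel_measurable torus_measure" for m
    unfolding tr_def by measurable
  have "(\<lambda>m. ?I (\<lambda>x. f x - tr m x)) \<longlonglongrightarrow> (\<integral>\<^sup>+ x. 0 \<partial>(torus_measure :: (real ^ 'n) measure))"
  proof (rule nn_integral_dominated_convergence[where w = "\<lambda>x. ennreal (cmod (f x) powr r)"])
    show "AE x in torus_measure. (\<lambda>m. ennreal (cmod (f x - tr m x) powr r)) \<longlonglongrightarrow> 0"
    proof (intro AE_I2 tendsto_powr_norm_diff_0 r tendsto_eventually)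
      fix x
      obtain m :: nat where "cmod (f x) \<le> m" using real_arch_simple by blast
      then show "eventually (\<lambda>m. tr m x = f x) sequentially"
        by (intro eventually_sequentiallyI[of m]) (auto simp: tr_def)
    qed
    show "(\<integral>\<^sup>+ x. ennreal (cmod (f x) powr r) \<partial>torus_measure) < \<infinity>" by (rule fin)
  qed (auto simp: tr_def intro!: AE_I2)
  then have "eventually (\<lambda>m. ?I (\<lambda>x. f x - tr m x) < \<eta>) sequentially"
    using \<eta> by (simp add: order_tendstoD)
  then obtain m where m: "?I (\<lambda>x. f x - tr m x) < \<eta>"
    by (auto simp: eventually_sequentially)
  have tr_meas: "tr m \<in> borel_measurable torus_measure" by measurable
  have tr_le: "cmod (tr m x) \<le> real m" for x by (simp add: tr_def)
  from bounded_measurable_AE_limit_trigpoly[OF tr_meas tr_le]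
  obtain T where T: "\<And>n :: nat. trigpoly (T n)"
    "\<And>n x. x \<in> cbox 0 (\<chi> i. 2 * pi) \<Longrightarrow> cmod (T n x) \<le> real m + 1"
    "AE x in torus_measure. (\<lambda>n. T n x) \<longlonglongrightarrow> tr m x" by auto
  have [measurable]: "T n \<in> borel_measurable torus_measure" for n
    by (intro borel_measurable_continuous_torus continuous_trigpoly T)
  have "(\<lambda>n. ?I (\<lambda>x. tr m x - T n x)) \<longlonglongrightarrow> (\<integral>\<^sup>+ x. 0 \<partial>(torus_measure :: (real ^ 'n) measure))"
  proof (rule nn_integral_dominated_convergence[where w = "\<lambda>x. ennreal ((2 * real m + 1) powr r)"])
    show "AE x in torus_measure. (\<lambda>n. ennreal (cmod (tr m x - T n x) powr r)) \<longlonglongrightarrow> 0"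
      using T(3) by eventually_elim (intro tendsto_powr_norm_diff_0 r)
    show "AE x in torus_measure. ennreal (cmod (tr m x - T n x) powr r) \<le> ennreal ((2 * real m + 1) powr r)" for n
    proof (intro AE_I2 ennreal_leI powr_mono2)
      fix x :: "real ^ 'n"
      assume "x \<in> space torus_measure"
      then show "cmod (tr m x - T n x) \<le> 2 * real m + 1"
        using T(2)[of x n] tr_le[of x] norm_triangle_ineq4[of "tr m x" "T n x"] by simp
    qed (use r in auto)
    show "(\<integral>\<^sup>+ x. ennreal ((2 * real m + 1) powr r) \<partial>(torus_measure :: (real ^ 'n) measure)) < \<infinity>"
      by (simp add: ennreal_mult_less_top less_top[symmetric] ennreal_mult_eq_top_iff del: space_torus_measure)
  qed auto
  then have "eventually (\<lambda>n. ?I (\<lambda>x. tr m x - T n x) < \<eta>) sequentially"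
    using \<eta> by (simp add: order_tendstoD)
  then obtain n where n: "?I (\<lambda>x. tr m x - T n x) < \<eta>"
    by (auto simp: eventually_sequentially)
  have "?I (\<lambda>x. f x - T n x) \<le>
      ennreal (2 powr r) * (?I (\<lambda>x. f x - tr m x) + ?I (\<lambda>x. tr m x - T n x))"
    by (intro nn_integral_powr_norm_triangle r) measurable
  also have "\<dots> \<le> ennreal (2 powr r) * (\<eta> + \<eta>)"
    using m n by (intro mult_left_mono add_mono less_imp_le) auto
  also have "\<dots> = ennreal \<epsilon>"
    using \<epsilon> by (simp add: \<eta>_def flip: ennreal_mult ennreal_plus)
  finally show thesis using T(1) by (intro that)
qed

section \<open>Fejer kernels in quasi-norms below 1\<close>

text \<open>
  Above the level \<open>l\<close> the concave power \<open>t\<^sup>p\<close> lies below the line \<open>l\<^sup>p\<^sup>-\<^sup>1 t\<close>, whose slope tends to 0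
  as \<open>l\<close> grows.
\<close>

lemma powr_le_min_powr_add:
  fixes t l p :: real
  assumes "0 \<le> t" "0 < l" "0 < p" "p < 1"
  shows "t powr p \<le> min t l powr p + l powr (p - 1) * t"
proof (cases "t \<le> l")
  case False
  then have "t powr p = t powr (p - 1) * t"
    using assms by (simp add: powr_diff)
  also have "t powr (p - 1) \<le> l powr (p - 1)"
    using assms False by (intro powr_mono2') auto
  finally show ?thesis
    using assms by (smt (verit) mult_right_mono powr_ge_zero)
qed (use assms in auto)

text \<open>
  The Fejer kernel in the coordinate \<open>i\<close>, constant in all others.
\<close>

definition fejer :: "'n \<Rightarrow> nat \<Rightarrow> real ^ 'n \<Rightarrow> real" where
  "fejer i n x = (cmod (\<Sum>j<n. cis (x $ i) ^ j))\<^sup>2 / real n"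

lemma fejer_nonneg [simp]: "0 \<le> fejer i n x"
  by (simp add: fejer_def)

lemma continuous_fejer [continuous_intros]: "continuous_on S (fejer i n)"
  unfolding fejer_def divide_inverse by (intro continuous_intros)

lemma fejer_eq_sum_wave:
  "complex_of_real (fejer i n x) = (\<Sum>j<n. \<Sum>l<n. wave (axis i (int j - int l)) x) / of_nat n"
proof -
  let ?D = "\<Sum>j<n. cis (x $ i) ^ j"
  have "complex_of_real ((cmod ?D)\<^sup>2) = ?D * cnj ?D"
    by (rule complex_norm_square)
  also have "\<dots> = (\<Sum>j<n. \<Sum>l<n. cis (x $ i) ^ j * cnj (cis (x $ i) ^ l))"
    by (simp add: sum_product)
  also have "\<dots> = (\<Sum>j<n. \<Sum>l<n. wave (axis i (int j - int l)) x)"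
    by (intro sum.cong refl) (simp add: wave_axis Complex.DeMoivre cis_cnj cis_mult algebra_simps)
  finally show ?thesis by (simp add: fejer_def)
qed

lemma integral_fejer:
  fixes i :: "'n::finite"
  assumes "0 < n"
  shows "integral\<^sup>L torus_measure (fejer i n) = (2 * pi) ^ CARD('n)"
proof -
  have "complex_of_real (integral\<^sup>L torus_measure (fejer i n)) =
      (\<integral>x. (\<Sum>j<n. \<Sum>l<n. wave (axis i (int j - int l)) x) / of_nat n \<partial>torus_measure)"
    by (simp flip: fejer_eq_sum_wave)
  also have "\<dots> = (\<Sum>j<n. \<Sum>l<n. integral\<^sup>L torus_measure (wave (axis i (int j - int l)))) / of_nat n"
    by (simp add: Bochner_Integration.integral_sum integrable_continuous_torus continuous_wave)
  also have "\<dots> = (\<Sum>j<n. \<Sum>l<n. if j = l then of_real ((2 * pi) ^ CARD('n)) else 0) / of_nat n"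
    by (simp add: integral_wave axis_eq_0_iff)
  also have "\<dots> = of_real ((2 * pi) ^ CARD('n))"
    using assms by simp
  finally show ?thesis by (simp only: of_real_eq_iff)
qed

lemma fejer_tendsto_0:
  assumes "sin (x $ i / 2) \<noteq> 0"
  shows "(\<lambda>n. fejer i n x) \<longlonglongrightarrow> 0"
proof -
  define w where "w = cis (x $ i)"
  have w: "w \<noteq> 1"
  proof
    assume "w = 1"
    then have "cos (x $ i) = 1" by (metis w_def cis.simps(1) one_complex.simps(1))
    moreover have "cos (x $ i) = 1 - 2 * (sin (x $ i / 2))\<^sup>2"
      using cos_double_sin[of "x $ i / 2"] by simp
    ultimately show False using assms by simp
  qed
  have le: "norm (fejer i n x) \<le> (2 / cmod (1 - w))\<^sup>2 * inverse (real n)" for n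
  proof -
    have "cmod (1 - w ^ n) \<le> 2"
      using norm_triangle_ineq4[of 1 "w ^ n"] by (simp add: norm_power w_def)
    then have "cmod ((1 - w ^ n) / (1 - w)) \<le> 2 / cmod (1 - w)"
      unfolding norm_divide by (intro divide_right_mono) auto
    moreover have "(\<Sum>j<n. w ^ j) = (1 - w ^ n) / (1 - w)"
      using w by (simp add: sum_gp_strict)
    ultimately have "(cmod (\<Sum>j<n. w ^ j))\<^sup>2 \<le> (2 / cmod (1 - w))\<^sup>2"
      by (intro power_mono) auto
    then have "(cmod (\<Sum>j<n. w ^ j))\<^sup>2 * inverse (real n) \<le> (2 / cmod (1 - w))\<^sup>2 * inverse (real n)"
      by (rule mult_right_mono) simp
    then show ?thesis
      using fejer_nonneg[of i n x] by (simp only: real_norm_def abs_of_nonneg fejer_def w_def divide_inverse)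
  qed
  have "(\<lambda>n. (2 / cmod (1 - w))\<^sup>2 * inverse (real n)) \<longlonglongrightarrow> (2 / cmod (1 - w))\<^sup>2 * 0"
    by (intro tendsto_intros lim_inverse_n)
  then have "(\<lambda>n. (2 / cmod (1 - w))\<^sup>2 * inverse (real n)) \<longlonglongrightarrow> 0"
    by (simp only: mult_zero_right)
  then show ?thesis
    by (rule Lim_null_comparison[OF always_eventually[OF allI[OF le]]])
qed

text \<open>
  The part of the kernel above a level \<open>l\<close> contributes at most \<open>l\<^sup>p\<^sup>-\<^sup>1\<close> times its integral, which does
  not depend on \<open>n\<close>. The part below \<open>l\<close> is bounded and tends to 0 almost everywhere.
\<close>

lemma fejer_powr_small:
  fixes i :: "'n::finite"
  assumes p: "0 < p" "p < 1" and \<epsilon>: "0 < \<epsilon>"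
  obtains n where "0 < n" "(\<integral>x. fejer i n x powr p \<partial>torus_measure) < \<epsilon>"
proof -
  let ?M = "torus_measure :: (real ^ 'n) measure"
  let ?V = "(2 * pi) ^ CARD('n)"
  have "((\<lambda>l. l powr (p - 1) * ?V) \<longlongrightarrow> 0 * ?V) at_top"
    using p by (intro tendsto_mult tendsto_const tendsto_neg_powr filterlim_ident) auto
  then have "eventually (\<lambda>l. l powr (p - 1) * ?V < \<epsilon> / 2 \<and> 0 < l) at_top"
    using \<epsilon> by (intro eventually_conj order_tendstoD(2)[of _ 0] eventually_gt_at_top) auto
  then obtain l where l: "l powr (p - 1) * ?V < \<epsilon> / 2" "0 < l"
    using eventually_happens'[OF trivial_limit_at_top_linorder] by blast
  have cont: "continuous_on UNIV (\<lambda>x. fejer i n x powr p)"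
    "continuous_on UNIV (\<lambda>x. min (fejer i n x) l powr p)" for n
    using p l by (intro continuous_on_powr' continuous_on_min continuous_fejer continuous_on_const; simp)+
  have "(\<lambda>n. \<integral>x. min (fejer i n x) l powr p \<partial>?M) \<longlonglongrightarrow> (\<integral>x. 0 \<partial>?M)"
  proof (rule integral_dominated_convergence)
    show "integrable ?M (\<lambda>x. l powr p)"
      by (intro integrable_continuous_torus continuous_intros)
    show "AE x in ?M. (\<lambda>n. min (fejer i n x) l powr p) \<longlonglongrightarrow> 0"
      using AE_torus_sin_half_nonzero
    proof eventually_elim
      case (elim x)
      have "(\<lambda>n. min (fejer i n x) l) \<longlonglongrightarrow> min 0 l"
        using elim by (intro tendsto_min tendsto_const fejer_tendsto_0) auto
      from tendsto_powr'[OF this tendsto_const, of p] p l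
      show ?case by simp
    qed
    show "AE x in ?M. norm (min (fejer i n x) l powr p) \<le> l powr p" for n
      using p l by (intro AE_I2) (auto intro!: powr_mono2)
    show "(\<lambda>x. min (fejer i n x) l powr p) \<in> borel_measurable ?M" for n
      by (intro borel_measurable_continuous_torus cont)
  qed auto
  then have "eventually (\<lambda>n. (\<integral>x. min (fejer i n x) l powr p \<partial>?M) < \<epsilon> / 2) sequentially"
    using \<epsilon> by (intro order_tendstoD(2)) auto
  then have "eventually (\<lambda>n. (\<integral>x. min (fejer i n x) l powr p \<partial>?M) < \<epsilon> / 2 \<and> 0 < n) sequentially"
    by (intro eventually_conj eventually_gt_at_top)
  then obtain n where n: "(\<integral>x. min (fejer i n x) l powr p \<partial>?M) < \<epsilon> / 2" "0 < n"
    using eventually_happens'[OF trivial_limit_sequentially] by blast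
  have int: "integrable ?M (\<lambda>x. fejer i n x powr p)"
    "integrable ?M (\<lambda>x. min (fejer i n x) l powr p)" "integrable ?M (fejer i n)"
    by (rule integrable_continuous_torus cont continuous_fejer)+
  have "(\<integral>x. fejer i n x powr p \<partial>?M) \<le> (\<integral>x. min (fejer i n x) l powr p + l powr (p - 1) * fejer i n x \<partial>?M)"
    using p l int by (intro integral_mono powr_le_min_powr_add) auto
  also have "\<dots> = (\<integral>x. min (fejer i n x) l powr p \<partial>?M) + l powr (p - 1) * ?V"
    using int by (simp add: integral_fejer[OF n(2)])
  also have "\<dots> < \<epsilon>" using n l by linarith
  finally show thesis using n(2) that by blast
qed

lemma wave_dilate: "wave k (real N *\<^sub>R x) = wave (\<chi> i. int N * k $ i) x"
proof -
  have "freq (\<chi> i. int N * k $ i) = real N *\<^sub>R freq k"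
    by (simp add: freq_def vec_eq_iff)
  then show ?thesis by (simp add: wave_def)
qed

lemma continuous_on_dilate:
  fixes f :: "'a::real_normed_vector \<Rightarrow> 'b::topological_space"
  assumes "continuous_on UNIV f"
  shows "continuous_on UNIV (\<lambda>x. f (real N *\<^sub>R x))"
  by (rule continuous_on_compose2[OF assms _ subset_UNIV]) (intro continuous_intros)

lemma integral_trigpoly_dilate:
  assumes "trigpoly T" "0 < N"
  shows "(\<integral>x. T (real N *\<^sub>R x) \<partial>torus_measure) = (\<integral>x. T x \<partial>torus_measure)"
  using assms(1)
proof induction
  case (monomial c k)
  have "(\<chi> i. int N * k $ i) = 0 \<longleftrightarrow> k = 0"
    using assms(2) by (auto simp: vec_eq_iff)
  then show ?case by (simp add: wave_dilate integral_wave)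
next
  case (add f g)
  then show ?case
    by (simp add: integrable_continuous_torus continuous_on_dilate continuous_trigpoly)
qed

text \<open>
  For trigonometric polynomials dilation by \<open>N\<close> only multiplies the frequencies by \<open>N\<close>, so the
  constant term, and with it the integral, stays the same. Uniform approximation on the whole
  torus carries this over to continuous functions.
\<close>

lemma integral_torus_dilate:
  fixes U :: "complex ^ 'n \<Rightarrow> complex"
  assumes U: "continuous_on UNIV U" and N: "0 < N"
  shows "(\<integral>x. U (torus_point (real N *\<^sub>R x)) \<partial>torus_measure) = (\<integral>x. U (torus_point x) \<partial>torus_measure)"
    (is "?L = ?R")
proof -
  let ?M = "torus_measure :: (real ^ 'n) measure"
  let ?V = "measure ?M (space ?M)"
  have contU: "continuous_on UNIV (\<lambda>x :: real ^ 'n. U (torus_point x))"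
    by (intro continuous_on_compose2[OF U] continuous_torus_point) auto
  have D: "cmod (?L - ?R) \<le> \<epsilon> * (2 * ?V)" if \<epsilon>: "0 < \<epsilon>" for \<epsilon>
  proof -
    obtain T where T: "trigpoly T" "\<And>x. cmod (U (torus_point x) - T x) < \<epsilon>"
      using trigpoly_dense_torus_point[OF continuous_on_subset[OF U subset_UNIV] \<epsilon>] by blast
    have D: "cmod (\<integral>x. (U (torus_point (real m *\<^sub>R x)) - T (real m *\<^sub>R x)) \<partial>?M) \<le> \<epsilon> * ?V" for m
    proof -
      have c: "continuous_on UNIV (\<lambda>x. U (torus_point (real m *\<^sub>R x)) - T (real m *\<^sub>R x))"
        using continuous_on_dilate[OF contU, of m] continuous_on_dilate[OF continuous_trigpoly[OF T(1)], of m]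
        by (intro continuous_intros)
      have "cmod (\<integral>x. (U (torus_point (real m *\<^sub>R x)) - T (real m *\<^sub>R x)) \<partial>?M)
          \<le> (\<integral>x. cmod (U (torus_point (real m *\<^sub>R x)) - T (real m *\<^sub>R x)) \<partial>?M)"
        by (rule integral_norm_bound)
      also have "\<dots> \<le> (\<integral>x. \<epsilon> \<partial>?M)"
        using T(2) by (intro integral_mono integrable_continuous_torus continuous_on_norm[OF c] continuous_on_const)
          (auto intro: less_imp_le)
      finally show ?thesis by (simp add: mult.commute del: space_torus_measure)
    qed
    have i: "integrable ?M (\<lambda>x. U (torus_point (real m *\<^sub>R x)))" "integrable ?M (\<lambda>x. T (real m *\<^sub>R x))" for m
      using continuous_on_dilate[OF contU, of m] continuous_on_dilate[OF continuous_trigpoly[OF T(1)], of m]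
      by (auto intro: integrable_continuous_torus)
    have "?L - ?R = (\<integral>x. (U (torus_point (real N *\<^sub>R x)) - T (real N *\<^sub>R x)) \<partial>?M)
        - (\<integral>x. (U (torus_point (real 1 *\<^sub>R x)) - T (real 1 *\<^sub>R x)) \<partial>?M)"
      using i[of N] i[of 1] integral_trigpoly_dilate[OF T(1) N] by simp
    also have "cmod \<dots> \<le> \<epsilon> * ?V + \<epsilon> * ?V"
      using D by (intro norm_triangle_le_diff add_mono)
    finally show ?thesis by simp
  qed
  have "cmod (?L - ?R) \<le> 0 + \<epsilon>" if "0 < \<epsilon>" for \<epsilon>
  proof -
    have "0 \<le> ?V" by simp
    then have pos: "0 < 2 * ?V + 1" by linarith
    then have "cmod (?L - ?R) \<le> \<epsilon> / (2 * ?V + 1) * (2 * ?V)"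
      using that by (intro D divide_pos_pos)
    also have "\<dots> \<le> \<epsilon>"
      using pos that unfolding times_divide_eq_left
      by (subst pos_divide_le_eq) (simp_all add: algebra_simps del: space_torus_measure)
    finally show ?thesis by simp
  qed
  then have "cmod (?L - ?R) \<le> 0"
    by (rule field_le_epsilon)
  then show ?thesis by simp
qed

lemma integral_fejer_powr_dilate:
  assumes "0 < p" "0 < N"
  shows "(\<integral>x. fejer i n (real N *\<^sub>R x) powr p \<partial>torus_measure) = (\<integral>x. fejer i n x powr p \<partial>torus_measure)"
proof -
  define U :: "complex ^ 'a \<Rightarrow> complex"
    where "U z = of_real (((cmod (\<Sum>j<n. (z $ i) ^ j))\<^sup>2 / real n) powr p)" for z
  have U: "U (torus_point x) = of_real (fejer i n x powr p)" for x
    by (simp add: U_def fejer_def torus_point_def)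
  have "continuous_on UNIV U"
    unfolding U_def divide_inverse using assms
    by (auto intro!: continuous_intros continuous_on_powr')
  from integral_torus_dilate[OF this assms(2)]
  have "complex_of_real (\<integral>x. fejer i n (real N *\<^sub>R x) powr p \<partial>torus_measure) =
     complex_of_real (\<integral>x. fejer i n x powr p \<partial>torus_measure)"
    by (simp add: U)
  then show ?thesis by (simp only: of_real_eq_iff)
qed

section \<open>Approximation by functions with small Weyl derivative\<close>

lemma fourier_coeff_add:
  assumes "integrable torus_measure f" "integrable torus_measure g"
  shows "fourier_coeff (\<lambda>x. f x + g x) k = fourier_coeff f k + fourier_coeff g k"
proof -
  have "integrable torus_measure (\<lambda>x. f x * wave (- k) x)"
    "integrable torus_measure (\<lambda>x. g x * wave (- k) x)"
    using trigpoly.monomial[of 1 "- k"] by (auto intro!: integrable_mult_trigpoly assms)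
  then show ?thesis
    by (simp add: fourier_coeff_wave distrib_right add_divide_distrib)
qed

lemma fourier_coeff_cmult: "fourier_coeff (\<lambda>x. c * f x) k = c * fourier_coeff f k"
  by (simp add: fourier_coeff_wave mult.assoc)

lemma fourier_coeff_wave_eq:
  fixes k l :: "int ^ 'n"
  shows "fourier_coeff (wave k) l = (if k = l then 1 else 0)"
proof -
  have "fourier_coeff (wave k) l = integral\<^sup>L torus_measure (wave (k - l)) / of_real ((2 * pi) ^ CARD('n))"
    by (simp add: fourier_coeff_wave flip: wave_add)
  then show ?thesis by (simp add: integral_wave)
qed

text \<open>
  A version of \<open>has_weyl_derivative\<close> in which both functions are continuous, so that all
  integrability side conditions are automatic.
\<close>

definition weyl_pair :: "(real ^ 'n \<Rightarrow> complex) \<Rightarrow> (real ^ 'n \<Rightarrow> complex) \<Rightarrow> (real ^ 'n \<Rightarrow> complex) \<Rightarrow> bool" where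
  "weyl_pair \<psi> g h \<longleftrightarrow> continuous_on UNIV g \<and> periodic g \<and> continuous_on UNIV h \<and> periodic h \<and>
    (\<forall>k. fourier_coeff h k = (if k = 0 then 0 else \<psi> (freq k) * fourier_coeff g k))"

lemma weyl_pair_add:
  assumes "weyl_pair \<psi> g h" "weyl_pair \<psi> g' h'"
  shows "weyl_pair \<psi> (\<lambda>x. g x + g' x) (\<lambda>x. h x + h' x)"
  using assms unfolding weyl_pair_def
  by (auto simp: periodic_def fourier_coeff_add integrable_continuous_torus distrib_left
      intro!: continuous_intros)

lemma weyl_pair_const: "weyl_pair \<psi> (\<lambda>x. c) (\<lambda>x. 0)"
proof -
  have "fourier_coeff (\<lambda>x. c * wave 0 x) k = (if 0 = k then c else 0)" for k :: "int ^ 'a"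
    by (simp only: fourier_coeff_cmult fourier_coeff_wave_eq) simp
  moreover have "fourier_coeff (\<lambda>x. 0) k = 0" for k :: "int ^ 'a"
    by (simp add: fourier_coeff_wave)
  ultimately show ?thesis
    by (auto simp: weyl_pair_def periodic_def)
qed

lemma weyl_pair_wave:
  assumes "k \<noteq> 0"
  shows "weyl_pair \<psi> (\<lambda>x. c * wave k x) (\<lambda>x. \<psi> (freq k) * c * wave k x)"
  using assms periodic_wave[of k]
  by (auto simp: weyl_pair_def periodic_def fourier_coeff_cmult fourier_coeff_wave_eq
      intro!: continuous_intros)

lemma weyl_pair_sum:
  assumes "finite A" "\<And>a. a \<in> A \<Longrightarrow> weyl_pair \<psi> (g a) (h a)"
  shows "weyl_pair \<psi> (\<lambda>x. \<Sum>a\<in>A. g a x) (\<lambda>x. \<Sum>a\<in>A. h a x)"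
  using assms
  by (induction rule: finite_induct) (auto intro: weyl_pair_const[of _ 0] weyl_pair_add)

text \<open>
  By homogeneity \<open>\<psi>(u + N v) = N\<^sup>\<alpha> \<psi>(u / N + v)\<close>, and the second factor tends to \<open>\<psi>(v) \<noteq> 0\<close>.
\<close>

lemma class_H_tendsto_infinity:
  fixes u v :: "real ^ 'n"
  assumes \<psi>: "\<psi> \<in> class_H \<alpha>" and "0 < \<alpha>" "v \<noteq> 0"
  shows "filterlim (\<lambda>N. cmod (\<psi> (u + real N *\<^sub>R v))) at_top sequentially"
proof -
  have "Ck_on 0 (UNIV - {0}) \<psi>"
    using \<psi> unfolding class_H_def C_infinity_on_def by blast
  then have "continuous_on (UNIV - {0}) \<psi>" by simp
  then have cont: "isCont \<psi> v"
    using \<open>v \<noteq> 0\<close> by (simp add: continuous_on_eq_continuous_at open_delete)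
  define w where "w N = inverse (real N) *\<^sub>R u + v" for N
  have "w \<longlonglongrightarrow> 0 *\<^sub>R u + v"
    unfolding w_def by (intro tendsto_intros lim_inverse_n)
  then have w: "w \<longlonglongrightarrow> v" by simp
  then have "(\<lambda>N. cmod (\<psi> (w N))) \<longlonglongrightarrow> cmod (\<psi> v)"
    by (intro tendsto_norm isCont_tendsto_compose[OF cont])
  moreover have "0 < cmod (\<psi> v)"
    using \<psi> \<open>v \<noteq> 0\<close> by (auto simp: class_H_def)
  moreover have "filterlim (\<lambda>N. exp (\<alpha> * ln (real N))) at_top sequentially"
    by (intro filterlim_compose[OF exp_at_top] filterlim_compose[OF ln_at_top]
        filterlim_tendsto_pos_mult_at_top[OF tendsto_const \<open>0 < \<alpha>\<close>] filterlim_real_sequentially)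
  ultimately have "filterlim (\<lambda>N. cmod (\<psi> (w N)) * exp (\<alpha> * ln (real N))) at_top sequentially"
    by (rule filterlim_tendsto_pos_mult_at_top)
  moreover have "eventually (\<lambda>N. w N \<noteq> 0) sequentially"
    using w \<open>v \<noteq> 0\<close> by (rule tendsto_imp_eventually_ne)
  then have "eventually (\<lambda>N. cmod (\<psi> (w N)) * exp (\<alpha> * ln (real N)) = cmod (\<psi> (u + real N *\<^sub>R v))) sequentially"
    using eventually_gt_at_top[of 0]
  proof eventually_elim
    case (elim N)
    then have "u + real N *\<^sub>R v = real N *\<^sub>R w N"
      by (simp add: w_def algebra_simps)
    moreover have "\<psi> (real N *\<^sub>R w N) = of_real (real N powr \<alpha>) * \<psi> (w N)"
      using \<psi> elim by (auto simp: class_H_def)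
    ultimately show ?case using elim by (simp add: norm_mult powr_def)
  qed
  ultimately show ?thesis
    by (simp cong: filterlim_cong)
qed

text \<open>
  Approximability in the form in which it is proved for waves. Uniform approximation is used
  because it is stronger than approximation in every \<open>L_q\<close>; the \<open>p\<close>-th power of the quasi-norm is
  used because it behaves well under addition.
\<close>

definition weyl_negligible :: "(real ^ 'n \<Rightarrow> complex) \<Rightarrow> real \<Rightarrow> (real ^ 'n \<Rightarrow> complex) \<Rightarrow> bool" where
  "weyl_negligible \<psi> p f \<longleftrightarrow> (\<forall>\<epsilon>>0. \<exists>g h. weyl_pair \<psi> g h \<and> (\<forall>x. cmod (f x - g x) \<le> \<epsilon>) \<and>
    (\<integral>x. cmod (h x) powr p \<partial>torus_measure) \<le> \<epsilon>)"

lemma continuous_powr_norm: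
  fixes h :: "real ^ 'n \<Rightarrow> complex"
  assumes "continuous_on S h" "0 < p"
  shows "continuous_on S (\<lambda>x. cmod (h x) powr p)"
  using assms by (intro continuous_on_powr' continuous_intros) auto

lemma weyl_negligible_add:
  assumes f: "weyl_negligible \<psi> p f" "weyl_negligible \<psi> p f'" and p: "0 < p"
  shows "weyl_negligible \<psi> p (\<lambda>x. f x + f' x)"
  unfolding weyl_negligible_def
proof (intro allI impI)
  fix \<epsilon> :: real
  assume \<epsilon>: "0 < \<epsilon>"
  define \<eta> where "\<eta> = \<epsilon> / (2 * 2 powr p)"
  have \<eta>: "0 < \<eta>" using \<epsilon> by (simp add: \<eta>_def)
  have "1 \<le> 2 powr p" using p by (simp add: ge_one_powr_ge_zero)
  then have \<eta>2: "\<eta> + \<eta> \<le> \<epsilon>" "2 powr p * (\<eta> + \<eta>) = \<epsilon>"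
    using \<epsilon> by (auto simp: \<eta>_def divide_simps)
  obtain g h where gh: "weyl_pair \<psi> g h" "\<And>x. cmod (f x - g x) \<le> \<eta>"
    "(\<integral>x. cmod (h x) powr p \<partial>torus_measure) \<le> \<eta>"
    using f(1) \<eta> unfolding weyl_negligible_def by blast
  obtain g' h' where gh': "weyl_pair \<psi> g' h'" "\<And>x. cmod (f' x - g' x) \<le> \<eta>"
    "(\<integral>x. cmod (h' x) powr p \<partial>torus_measure) \<le> \<eta>"
    using f(2) \<eta> unfolding weyl_negligible_def by blast
  have "continuous_on UNIV h" "continuous_on UNIV h'"
    using gh(1) gh'(1) by (auto simp: weyl_pair_def)
  then have int: "integrable torus_measure (\<lambda>x. cmod (h x) powr p)"
    "integrable torus_measure (\<lambda>x. cmod (h' x) powr p)"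
    "integrable torus_measure (\<lambda>x. cmod (h x + h' x) powr p)"
    using p by (auto intro!: integrable_continuous_torus continuous_powr_norm continuous_intros)
  have "(\<integral>x. cmod (h x + h' x) powr p \<partial>torus_measure)
      \<le> (\<integral>x. 2 powr p * (cmod (h x) powr p + cmod (h' x) powr p) \<partial>torus_measure)"
    using int p by (intro integral_mono powr_norm_add_le) auto
  also have "\<dots> = 2 powr p * ((\<integral>x. cmod (h x) powr p \<partial>torus_measure) + (\<integral>x. cmod (h' x) powr p \<partial>torus_measure))"
    using int by simp
  also have "\<dots> \<le> 2 powr p * (\<eta> + \<eta>)"
    using gh(3) gh'(3) by (intro mult_left_mono add_mono) auto
  finally have h: "(\<integral>x. cmod (h x + h' x) powr p \<partial>torus_measure) \<le> \<epsilon>"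
    by (simp only: \<eta>2)
  have "cmod (f x + f' x - (g x + g' x)) \<le> \<epsilon>" for x
    using norm_triangle_mono[OF gh(2)[of x] gh'(2)[of x]] \<eta>2(1) by (simp add: algebra_simps)
  with weyl_pair_add[OF gh(1) gh'(1)] h
  show "\<exists>g h. weyl_pair \<psi> g h \<and> (\<forall>x. cmod (f x + f' x - g x) \<le> \<epsilon>) \<and>
    (\<integral>x. cmod (h x) powr p \<partial>torus_measure) \<le> \<epsilon>" by blast
qed

text \<open>
  The function \<open>h\<close> is \<open>\<psi>(D)\<close> of the wave multiplied by the dilated Fejer kernel. Expanding the kernel
  as a double sum of waves with frequencies \<open>N (j - l) e_i\<close> shows that \<open>g = \<psi>(D)\<inverse> h\<close> consists of the
  given wave (the terms with \<open>j = l\<close>) and terms whose coefficients tend to 0 as \<open>N \<rightarrow> \<infinity>\<close>.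
  First \<open>n\<close> is chosen to make \<open>h\<close> small, then \<open>N\<close> to make \<open>g\<close> close to the wave.
\<close>

lemma weyl_negligible_wave:
  fixes k :: "int ^ 'n"
  assumes \<psi>: "\<psi> \<in> class_H \<alpha>" "0 < \<alpha>" and p: "0 < p" "p < 1"
  shows "weyl_negligible \<psi> p (\<lambda>x. c * wave k x)"
proof (cases "k = 0")
  case True
  then show ?thesis
    unfolding weyl_negligible_def
    by (intro allI impI exI[of _ "\<lambda>x. c"] exI[of _ "\<lambda>x. 0"]) (auto simp: weyl_pair_const)
next
  case False
  show ?thesis
    unfolding weyl_negligible_def
  proof (intro allI impI)
    fix \<epsilon> :: real
    assume \<epsilon>: "0 < \<epsilon>"
    \<comment> \<open>Any coordinate direction will do; index types are inhabited.\<close>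
    define i :: 'n where "i = undefined"
    define A where "A = cmod (\<psi> (freq k) * c) powr p"
    have A: "0 \<le> A" by (simp add: A_def)
    \<comment> \<open>The summand 1 avoids division by 0 when \<open>c = 0\<close>.\<close>
    have "0 < \<epsilon> / (A + 1)" using \<epsilon> A by simp
    from fejer_powr_small[OF p this, of i]
    obtain n where n: "0 < n" "(\<integral>x. fejer i n x powr p \<partial>torus_measure) < \<epsilon> / (A + 1)" by blast
    define fr where "fr N j l = k + axis i (int N * (int j - int l))" for N j l :: nat
    define a where "a N j l = \<psi> (freq k) / \<psi> (freq (fr N j l))" for N j l
    define b where "b N j l = (if j = l then 0 else cmod (a N j l))" for N j l
    have freq_fr: "freq (fr N j l) = freq k + real N *\<^sub>R axis i (of_int (int j - int l))" for N j l
      by (auto simp: fr_def freq_def vec_eq_iff axis_def)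
    have "(\<lambda>N. b N j l) \<longlonglongrightarrow> 0" for j l
    proof (cases "j = l")
      case False
      have "filterlim (\<lambda>N. cmod (\<psi> (freq (fr N j l)))) at_top sequentially"
        unfolding freq_fr using False
        by (intro class_H_tendsto_infinity[OF \<psi>]) (simp add: axis_eq_0_iff)
      then have "(\<lambda>N. cmod (\<psi> (freq k)) / cmod (\<psi> (freq (fr N j l)))) \<longlonglongrightarrow> 0"
        by (intro tendsto_divide_0[OF tendsto_const] filterlim_at_top_imp_at_infinity)
      with False show ?thesis by (simp add: b_def a_def norm_divide)
    qed (simp add: b_def)
    then have "(\<lambda>N. cmod c / real n * (\<Sum>j<n. \<Sum>l<n. b N j l)) \<longlonglongrightarrow> cmod c / real n * (\<Sum>j<n. \<Sum>l<n. 0)"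
      by (intro tendsto_intros)
    then have "eventually (\<lambda>N. cmod c / real n * (\<Sum>j<n. \<Sum>l<n. b N j l) < \<epsilon>) sequentially"
      using \<epsilon> by (intro order_tendstoD) auto
    \<comment> \<open>For such \<open>N\<close> no shifted frequency is 0, where \<open>\<psi>(D)\<close> would lose a term.\<close>
    moreover have "eventually (\<lambda>N. nat \<bar>k $ i\<bar> < N) sequentially"
      by (rule eventually_gt_at_top)
    ultimately have "eventually (\<lambda>N. cmod c / real n * (\<Sum>j<n. \<Sum>l<n. b N j l) < \<epsilon> \<and> nat \<bar>k $ i\<bar> < N) sequentially"
      by (rule eventually_conj)
    then obtain N where N: "cmod c / real n * (\<Sum>j<n. \<Sum>l<n. b N j l) < \<epsilon>" "nat \<bar>k $ i\<bar> < N"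
      using eventually_happens'[OF trivial_limit_sequentially] by blast
    have fr0: "fr N j l \<noteq> 0" for j l
    proof
      assume "fr N j l = 0"
      then have "fr N j l $ i = 0" by simp
      then have "k $ i = - (int N * (int j - int l))"
        by (simp add: fr_def axis_def eq_neg_iff_add_eq_0)
      then have "\<bar>k $ i\<bar> = int N * \<bar>int j - int l\<bar>"
        by (simp only: abs_minus_cancel abs_mult abs_of_nat)
      with N(2) have "int N * \<bar>int j - int l\<bar> < int N * 1" by linarith
      then have "j = l" unfolding mult_less_cancel_left by auto
      then have "fr N j l = k" by (simp add: fr_def vec_eq_iff axis_def)
      with \<open>fr N j l = 0\<close> \<open>k \<noteq> 0\<close> show False by simp
    qed
    have \<psi>0: "\<psi> (freq (fr N j l)) \<noteq> 0" for j l
      using \<psi> fr0 by (auto simp: class_H_def)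
    define g where "g x = (\<Sum>j<n. \<Sum>l<n. c / of_nat n * a N j l * wave (fr N j l) x)" for x
    define h where "h x = (\<Sum>j<n. \<Sum>l<n. \<psi> (freq (fr N j l)) * (c / of_nat n * a N j l) * wave (fr N j l) x)" for x
    have "weyl_pair \<psi> g h"
      unfolding g_def h_def by (rule weyl_pair_sum weyl_pair_wave finite_lessThan fr0)+
    moreover have "cmod (c * wave k x - g x) \<le> \<epsilon>" for x
    proof -
      have "c * wave k x = (\<Sum>j<n. \<Sum>l<n. if j = l then c / of_nat n * wave k x else 0)"
        using n(1) by simp
      then have "c * wave k x - g x = (\<Sum>j<n. \<Sum>l<n. (if j = l then c / of_nat n * wave k x else 0)
          - c / of_nat n * a N j l * wave (fr N j l) x)"
        by (simp only: g_def sum_subtractf)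
      also have "cmod \<dots> \<le> (\<Sum>j<n. \<Sum>l<n. cmod c / real n * b N j l)"
      proof (intro sum_norm_le)
        fix j l
        have "a N j j = 1" "fr N j j = k" for j
          using \<psi>0[of j j] by (simp_all add: a_def fr_def axis_eq_0_iff[THEN iffD2])
        then show "cmod ((if j = l then c / of_nat n * wave k x else 0)
          - c / of_nat n * a N j l * wave (fr N j l) x) \<le> cmod c / real n * b N j l"
          by (auto simp: b_def norm_mult norm_divide)
      qed
      also have "\<dots> = cmod c / real n * (\<Sum>j<n. \<Sum>l<n. b N j l)"
        by (simp only: sum_distrib_left)
      finally show ?thesis using N(1) by simp
    qed
    moreover have "(\<integral>x. cmod (h x) powr p \<partial>torus_measure) \<le> \<epsilon>"
    proof -
      have h: "h x = \<psi> (freq k) * c * wave k x * of_real (fejer i n (real N *\<^sub>R x))" for x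
      proof -
        have "wave (fr N j l) x = wave k x * wave (axis i (int j - int l)) (real N *\<^sub>R x)" for j l
          by (simp add: fr_def wave_add wave_axis mult_ac)
        then have eq: "\<psi> (freq (fr N j l)) * (c / of_nat n * a N j l) * wave (fr N j l) x =
            \<psi> (freq k) * c * wave k x * (wave (axis i (int j - int l)) (real N *\<^sub>R x) / of_nat n)" for j l
          using \<psi>0[of j l] by (simp add: a_def)
        then show ?thesis
          unfolding h_def fejer_eq_sum_wave sum_divide_distrib sum_distrib_left
          by (intro sum.cong refl eq)
      qed
      have "(\<integral>x. cmod (h x) powr p \<partial>torus_measure)
          = (\<integral>x. A * fejer i n (real N *\<^sub>R x) powr p \<partial>torus_measure)"
        by (simp add: h norm_mult powr_mult A_def)
      also have "\<dots> = A * (\<integral>x. fejer i n x powr p \<partial>torus_measure)"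
        using N(2) p by (simp add: integral_fejer_powr_dilate)
      also have "\<dots> \<le> A * (\<epsilon> / (A + 1))"
        using n(2) A by (intro mult_left_mono) auto
      also have "\<dots> \<le> \<epsilon>"
        using A \<epsilon> by (simp add: divide_simps)
      finally show ?thesis .
    qed
    ultimately show "\<exists>g h. weyl_pair \<psi> g h \<and> (\<forall>x. cmod (c * wave k x - g x) \<le> \<epsilon>) \<and>
      (\<integral>x. cmod (h x) powr p \<partial>torus_measure) \<le> \<epsilon>" by blast
  qed
qed

lemma weyl_negligible_trigpoly:
  assumes "trigpoly T" "\<psi> \<in> class_H \<alpha>" "0 < \<alpha>" "0 < p" "p < 1"
  shows "weyl_negligible \<psi> p T"
  using assms(1)
  by induction (auto intro: weyl_negligible_wave weyl_negligible_add assms)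

section \<open>Quasi-norms and the K-functional\<close>

lemma AE_eq_of_fourier_coeff_eq:
  assumes "integrable torus_measure h" "integrable torus_measure h'"
    "\<And>k. fourier_coeff h k = fourier_coeff h' k"
  shows "AE x in torus_measure. h x = h' x"
proof -
  have "fourier_coeff (\<lambda>x. h x + (- 1) * h' x) k = 0" for k
  proof -
    have "integrable torus_measure (\<lambda>x. (- 1) * h' x)" using assms by simp
    from fourier_coeff_add[OF assms(1) this, of k] show ?thesis
      unfolding fourier_coeff_cmult assms(3) by simp
  qed
  then have "AE x in torus_measure. h x + (- 1) * h' x = 0"
    using assms by (intro AE_eq_0_of_fourier_coeff_0) auto
  then show ?thesis by simp
qed

lemma torus_norm_le:
  assumes r: "0 < r" and e: "0 \<le> e"
    and le: "(\<integral>\<^sup>+ x. ennreal (cmod (f x) powr r) \<partial>torus_measure) \<le> ennreal (e powr r)"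
  shows "torus_norm (ennreal r) f \<le> ennreal e"
proof -
  let ?J = "\<integral>\<^sup>+ x. ennreal (cmod (f x) powr r) \<partial>torus_measure"
  have J: "?J \<noteq> \<infinity>" using le by (auto simp: top_unique)
  have "enn2real ?J \<le> e powr r"
    using le by (simp add: enn2real_leI)
  then have "enn2real ?J powr (1 / r) \<le> (e powr r) powr (1 / r)"
    using r by (intro powr_mono2) auto
  also have "\<dots> = e" using r e by (simp add: powr_powr)
  finally show ?thesis
    using J r by (simp add: torus_norm_def ennreal_leI)
qed

lemma torus_norm_finite_iff:
  assumes "0 < r"
  shows "torus_norm (ennreal r) f < \<infinity> \<longleftrightarrow> (\<integral>\<^sup>+ x. ennreal (cmod (f x) powr r) \<partial>torus_measure) < \<infinity>"
  using assms by (auto simp: torus_norm_def Let_def less_top)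

lemma integrable_torus_L1:
  assumes "h \<in> torus_L 1"
  shows "integrable torus_measure h"
proof -
  have "torus_norm (ennreal 1) h < \<infinity>"
    using assms by (simp add: torus_L_def)
  then have "(\<integral>\<^sup>+ x. ennreal (cmod (h x)) \<partial>torus_measure) < \<infinity>"
    by (subst (asm) torus_norm_finite_iff) auto
  then show ?thesis
    using assms by (auto simp: torus_L_def integrable_iff_bounded)
qed

lemma nn_integral_continuous_powr:
  fixes h :: "real ^ 'n \<Rightarrow> complex"
  assumes "continuous_on UNIV h" "0 < r"
  shows "(\<integral>\<^sup>+ x. ennreal (cmod (h x) powr r) \<partial>torus_measure) = ennreal (\<integral>x. cmod (h x) powr r \<partial>torus_measure)"
  using assms by (intro nn_integral_eq_integral integrable_continuous_torus continuous_powr_norm) auto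

lemma continuous_in_torus_L:
  fixes h :: "real ^ 'n \<Rightarrow> complex"
  assumes "continuous_on UNIV h" "periodic h" "0 < r"
  shows "h \<in> torus_L (ennreal r)"
  using assms unfolding torus_L_def
  by (simp add: torus_norm_finite_iff[simplified] nn_integral_continuous_powr borel_measurable_continuous_torus)

text \<open>
  The chosen representative \<open>weyl_derivative \<psi> g\<close> has the same Fourier coefficients as \<open>h\<close>, so it
  agrees with \<open>h\<close> almost everywhere and inherits its quasi-norm.
\<close>

lemma weyl_pair_weyl_space:
  assumes gh: "weyl_pair \<psi> g h" and p: "0 < p" and e: "0 \<le> e"
    and le: "(\<integral>x. cmod (h x) powr p \<partial>torus_measure) \<le> e powr p"
  shows "g \<in> weyl_space (ennreal p) \<psi>" "torus_norm (ennreal p) (weyl_derivative \<psi> g) \<le> ennreal e"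
proof -
  have c: "continuous_on UNIV g" "periodic g" "continuous_on UNIV h" "periodic h"
    and coeff: "\<And>k. fourier_coeff h k = (if k = 0 then 0 else \<psi> (freq k) * fourier_coeff g k)"
    using gh by (auto simp: weyl_pair_def)
  have L1: "g \<in> torus_L 1" "h \<in> torus_L 1"
    using continuous_in_torus_L[of g 1] continuous_in_torus_L[of h 1] c by auto
  have h: "has_weyl_derivative \<psi> g h"
    using L1 coeff by (simp add: has_weyl_derivative_def)
  define h' where "h' = weyl_derivative \<psi> g"
  have h': "has_weyl_derivative \<psi> g h'"
    unfolding h'_def weyl_derivative_def using h by (rule someI[of "has_weyl_derivative \<psi> g"])
  then have L1': "h' \<in> torus_L 1" by (simp add: has_weyl_derivative_def)
  have "AE x in torus_measure. h' x = h x"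
    using h h' L1 L1' by (intro AE_eq_of_fourier_coeff_eq integrable_torus_L1) (auto simp: has_weyl_derivative_def)
  then have "(\<integral>\<^sup>+ x. ennreal (cmod (h' x) powr p) \<partial>torus_measure) = (\<integral>\<^sup>+ x. ennreal (cmod (h x) powr p) \<partial>torus_measure)"
    by (intro nn_integral_cong_AE) auto
  also have "\<dots> \<le> ennreal (e powr p)"
    using le c p by (simp add: nn_integral_continuous_powr ennreal_leI)
  finally have n: "torus_norm (ennreal p) h' \<le> ennreal e"
    by (rule torus_norm_le[OF p e])
  then show "torus_norm (ennreal p) (weyl_derivative \<psi> g) \<le> ennreal e"
    by (simp add: h'_def)
  have "torus_norm (ennreal p) h' < \<infinity>" using n by (simp add: le_less_trans)
  with L1' have "h' \<in> torus_L (ennreal p)" by (simp add: torus_L_def)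
  with L1 h show "g \<in> weyl_space (ennreal p) \<psi>"
    unfolding weyl_space_def by (auto simp: h'_def)
qed

text \<open>
  The torus has finite measure, so a uniformly small change of \<open>T\<close> changes the integral of the
  \<open>r\<close>-th power only slightly. The factors 2 and \<open>2\<^sup>r\<close> in the hypothesis pay for the
  quasi-triangle inequality.
\<close>

lemma torus_norm_uniform_perturbation:
  fixes f T :: "real ^ 'n \<Rightarrow> complex"
  assumes f: "f \<in> borel_measurable torus_measure" and T: "continuous_on UNIV T"
    and r: "0 < r" and e: "0 < e"
    and le: "(\<integral>\<^sup>+ x. ennreal (cmod (f x - T x) powr r) \<partial>torus_measure) \<le> ennreal (e powr r / (2 * 2 powr r))"
  obtains \<eta> where "0 < \<eta>"
    "\<And>g. continuous_on UNIV g \<Longrightarrow> (\<And>x. cmod (T x - g x) \<le> \<eta>) \<Longrightarrow> torus_norm (ennreal r) (\<lambda>x. f x - g x) \<le> ennreal e"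
proof -
  let ?M = "torus_measure :: (real ^ 'n) measure"
  interpret finite_measure ?M by (rule finite_measure_torus)
  define V where "V = measure ?M (space ?M)"
  have V: "0 \<le> V" by (simp add: V_def)
  define d where "d = e powr r / (2 * 2 powr r)"
  have d: "0 < d" using e by (simp add: d_def)
  define \<eta> where "\<eta> = (d / (V + 1)) powr (1 / r)"
  have "0 < d / (V + 1)" using d V by simp
  then have \<eta>: "0 < \<eta>" "\<eta> powr r = d / (V + 1)"
    using r d V by (auto simp: \<eta>_def powr_powr)
  have [measurable]: "f \<in> borel_measurable ?M" "T \<in> borel_measurable ?M"
    using f T by (auto intro: borel_measurable_continuous_torus)
  show thesis
  proof
    show "0 < \<eta>" by (rule \<eta>)
    fix g
    assume "continuous_on UNIV g" and g: "cmod (T x - g x) \<le> \<eta>" for x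
    then have [measurable]: "g \<in> borel_measurable ?M"
      by (auto intro: borel_measurable_continuous_torus)
    have "(\<integral>\<^sup>+ x. ennreal (cmod (T x - g x) powr r) \<partial>?M) \<le> (\<integral>\<^sup>+ x. ennreal (d / (V + 1)) \<partial>?M)"
      unfolding \<eta>(2)[symmetric] using r
      by (intro nn_integral_mono ennreal_leI powr_mono2 g) simp_all
    also have "\<dots> = ennreal (d / (V + 1) * V)"
      unfolding nn_integral_const emeasure_eq_measure V_def[symmetric]
      using d V by (subst ennreal_mult) auto
    also have "\<dots> \<le> ennreal d"
      using d V by (intro ennreal_leI) (simp add: divide_simps)
    finally have g': "(\<integral>\<^sup>+ x. ennreal (cmod (T x - g x) powr r) \<partial>?M) \<le> ennreal d" .
    have "(\<integral>\<^sup>+ x. ennreal (cmod (f x - g x) powr r) \<partial>?M)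
        \<le> ennreal (2 powr r) * ((\<integral>\<^sup>+ x. ennreal (cmod (f x - T x) powr r) \<partial>?M)
            + (\<integral>\<^sup>+ x. ennreal (cmod (T x - g x) powr r) \<partial>?M))"
      by (intro nn_integral_powr_norm_triangle r) measurable
    also have "\<dots> \<le> ennreal (2 powr r) * (ennreal d + ennreal d)"
      using le g' by (intro mult_left_mono add_mono) (auto simp: d_def)
    also have "\<dots> = ennreal (e powr r)"
      using e by (simp add: d_def flip: ennreal_mult ennreal_plus)
    finally show "torus_norm (ennreal r) (\<lambda>x. f x - g x) \<le> ennreal e"
      using e by (intro torus_norm_le r) auto
  qed
qed

text \<open>
  The common form of density for \<open>q < \<infinity>\<close> and \<open>q = \<infinity>\<close>: some trigonometric polynomial is near \<open>f\<close>
  together with all continuous functions uniformly close to it.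
\<close>

lemma exists_trigpoly_uniform_neighbourhood:
  fixes f :: "real ^ 'n \<Rightarrow> complex"
  assumes "0 < q" "f \<in> torus_L q" "q = \<infinity> \<Longrightarrow> continuous_on UNIV f" "0 < e"
  obtains T \<eta> where "trigpoly T" "0 < \<eta>"
    "\<And>g. continuous_on UNIV g \<Longrightarrow> (\<And>x. cmod (T x - g x) \<le> \<eta>) \<Longrightarrow> torus_norm q (\<lambda>x. f x - g x) \<le> ennreal e"
proof (cases "q = \<infinity>")
  case True
  then have f: "continuous_on UNIV f" "periodic f"
    using assms by (auto simp: torus_L_def)
  have "0 < e / 2" using \<open>0 < e\<close> by simp
  from trigpoly_dense_cube[OF continuous_on_subset[OF f(1) subset_UNIV] this periodic_fibre[OF f(2)]]
  obtain T where T: "trigpoly T" "\<And>x. x \<in> cbox 0 (\<chi> i. 2 * pi) \<Longrightarrow> cmod (f x - T x) < e / 2"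
    by blast
  show thesis
  proof (rule that[OF T(1) \<open>0 < e / 2\<close>])
    fix g
    assume g: "continuous_on UNIV g" "\<And>x. cmod (T x - g x) \<le> e / 2"
    have [measurable]: "(\<lambda>x. f x - g x) \<in> borel_measurable torus_measure"
      using f g by (intro borel_measurable_continuous_torus continuous_intros)
    have "cmod (f x - g x) \<le> e" if "x \<in> cbox 0 (\<chi> i. 2 * pi)" for x
      using norm_triangle_mono[OF less_imp_le[OF T(2)[OF that]] g(2)[of x]] by simp
    then have "AE x in torus_measure. ennreal (cmod (f x - g x)) \<le> ennreal e"
      by (intro AE_I2 ennreal_leI) simp
    then show "torus_norm q (\<lambda>x. f x - g x) \<le> ennreal e"
      using True by (simp add: torus_norm_def esssup_I)
  qed
next
  case False
  define r where "r = enn2real q"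
  have q: "q = ennreal r" "0 < r"
    using False \<open>0 < q\<close> by (simp_all add: r_def less_top[symmetric] enn2real_positive_iff)
  have f: "f \<in> borel_measurable torus_measure" "(\<integral>\<^sup>+ x. ennreal (cmod (f x) powr r) \<partial>torus_measure) < \<infinity>"
    using assms(2) q by (auto simp: torus_L_def torus_norm_finite_iff[simplified])
  have "0 < e powr r / (2 * 2 powr r)" using \<open>0 < e\<close> by simp
  from trigpoly_dense_powr[OF f(1) q(2) f(2) this]
  obtain T where T: "trigpoly T"
    "(\<integral>\<^sup>+ x. ennreal (cmod (f x - T x) powr r) \<partial>torus_measure) \<le> ennreal (e powr r / (2 * 2 powr r))"
    by blast
  from torus_norm_uniform_perturbation[OF f(1) continuous_trigpoly[OF T(1)] q(2) \<open>0 < e\<close> T(2)]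
  obtain \<eta> where \<eta>: "0 < \<eta>"
    "\<And>g. continuous_on UNIV g \<Longrightarrow> (\<And>x. cmod (T x - g x) \<le> \<eta>) \<Longrightarrow>
      torus_norm (ennreal r) (\<lambda>x. f x - g x) \<le> ennreal e"
    by blast
  show thesis
    by (rule that[OF T(1) \<eta>(1)]) (unfold q(1), rule \<eta>(2))
qed

theorem theorem3p1:
  fixes p \<alpha> \<delta> :: real and q :: ennreal
    and \<psi> f :: "real ^ 'n \<Rightarrow> complex"
  assumes "0 < p" and "p < 1"
    and "0 < q"
    and "\<alpha> > max 0 (real CARD('n) * (1 - enn2real (1 / q)))"
    and "\<psi> \<in> class_H \<alpha>"
    and "f \<in> torus_L q"
    and "q = \<infinity> \<Longrightarrow> continuous_on UNIV f"
    and "\<delta> > 0"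
  shows "K_functional q (ennreal p) \<psi> f \<delta> = 0"
proof -
  have \<alpha>: "0 < \<alpha>" using assms(4) by simp
  have "K_functional q (ennreal p) \<psi> f \<delta> \<le> 0 + ennreal e" if "0 < e" for e
  proof -
    have "0 < e / 2" using that by simp
    from exists_trigpoly_uniform_neighbourhood[OF \<open>0 < q\<close> \<open>f \<in> torus_L q\<close> assms(7) this]
    obtain T \<eta> where T: "trigpoly T" "0 < \<eta>"
      and close: "\<And>g. continuous_on UNIV g \<Longrightarrow> (\<And>x. cmod (T x - g x) \<le> \<eta>) \<Longrightarrow>
        torus_norm q (\<lambda>x. f x - g x) \<le> ennreal (e / 2)"
      by blast
    define \<epsilon> where "\<epsilon> = min \<eta> ((e / (2 * \<delta>)) powr p)"
    have \<epsilon>: "0 < \<epsilon>" using T(2) \<open>0 < e\<close> \<open>\<delta> > 0\<close> by (simp add: \<epsilon>_def)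
    have "weyl_negligible \<psi> p T"
      by (rule weyl_negligible_trigpoly[OF T(1) assms(5) \<alpha> assms(1,2)])
    with \<epsilon> obtain g h where gh: "weyl_pair \<psi> g h" "\<And>x. cmod (T x - g x) \<le> \<epsilon>"
      "(\<integral>x. cmod (h x) powr p \<partial>torus_measure) \<le> \<epsilon>"
      unfolding weyl_negligible_def by blast
    have e: "0 \<le> e / (2 * \<delta>)" using \<open>0 < e\<close> \<open>\<delta> > 0\<close> by simp
    have h: "(\<integral>x. cmod (h x) powr p \<partial>torus_measure) \<le> (e / (2 * \<delta>)) powr p"
      using gh(3) by (simp add: \<epsilon>_def)
    note g = weyl_pair_weyl_space[OF gh(1) \<open>0 < p\<close> e h]
    have K: "K_functional q (ennreal p) \<psi> f \<delta>
        \<le> torus_norm q (\<lambda>x. f x - g x) + ennreal \<delta> * torus_norm (ennreal p) (weyl_derivative \<psi> g)"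
      unfolding K_functional_def by (rule INF_lower[OF g(1)])
    have "torus_norm q (\<lambda>x. f x - g x) \<le> ennreal (e / 2)"
    proof (rule close)
      show "continuous_on UNIV g" using gh(1) by (simp add: weyl_pair_def)
      show "cmod (T x - g x) \<le> \<eta>" for x using gh(2)[of x] by (simp add: \<epsilon>_def)
    qed
    then have "torus_norm q (\<lambda>x. f x - g x) + ennreal \<delta> * torus_norm (ennreal p) (weyl_derivative \<psi> g)
        \<le> ennreal (e / 2) + ennreal \<delta> * ennreal (e / (2 * \<delta>))"
      by (rule add_mono) (rule mult_left_mono[OF g(2) zero_le])
    also have "\<dots> = ennreal (e / 2) + ennreal (e / 2)"
      using e \<open>\<delta> > 0\<close> by (subst ennreal_mult[symmetric]) simp_all
    also have "\<dots> = ennreal e"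
      using \<open>0 < e / 2\<close> by (subst ennreal_plus[symmetric]) simp_all
    finally have "K_functional q (ennreal p) \<psi> f \<delta> \<le> ennreal e"
      by (rule order_trans[OF K])
    then show ?thesis by simp
  qed
  then have "K_functional q (ennreal p) \<psi> f \<delta> \<le> 0"
    by (rule ennreal_le_epsilon)
  then show ?thesis by simp
qed

end
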